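(* For the optimal policy $\pi^*$ there exists a threshold queue length $l^{th}_{\pi^*}$ such that for all $l\ge l^{th}_{\pi^*}$ and all $k\in\{1,2,\ldots\}$ it holds that $\pi^*(l,k)=1$ (drop). Furthermore, this queue-length threshold is always finite, and more specifically $$l^{th}_{\pi^*}\le\delta\,\max_{k}q_{k+1}+(1-\lambda),$$ where the maximum is over $k\in\{1,2,\ldots\}$.
   Context: Let $0<\lambda\le1$ (Bernoulli arrival probability per slot), $\delta>0$ (dropping penalty), and let $\{q_k\}_{k\ge1}$ be a given sequence of success probabilities, with $p_k=1-q_k$ (no monotonicity is assumed). Consider the Markov decision process with state space $\mathcal S=\mathbf N\times\mathbf N_+$, where $\mathbf N=\{0,1,2,\ldots\}$ and $\mathbf N_+=\{1,2,\ldots\}$; a state $(l,k)$ consists of the queue length $l$ and the current retransmission number $k$. The action set is $\{0,1\}$, where $0$ means "continue" (retransmit in the next slot if the current transmission fails) and $1$ means "drop" (remove the packet whatever the outcome of the current transmission). Transitions. For $l\ge1$ and action $0$: from $(l,k)$ go to $(l-1,1)$ with probability $q_k(1-\lambda)$, to $(l,1)$ with probability $q_k\lambda$, to $(l,k+1)$ with probability $p_k(1-\lambda)$, to $(l+1,k+1)$ with probability $p_k\lambda$. For $l\ge1$ and action $1$: go to $(l-1,1)$ with probability $1-\lambda$ and to $(l,1)$ with probability $\lambda$. For $l=0$ and either action: go from $(0,k)$ to $(1,k)$ with probability $\lambda$ and to $(0,k)$ with probability $1-\lambda$. Cost per slot: $c_\delta((l,k),a)=l+\delta a p_k$ for $l\ge1$,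 and $c_\delta((0,k),a)=0$. For a history-dependent randomized policy $\pi$ and initial state $S_o$, the average expected cost is $J_\pi(\delta,S_o)=\limsup_{N\to\infty}\frac1N\mathbf E^{\pi,S_o}\big[\sum_{n=1}^N c_\delta(S_n,A_n)\big]$, where $S_n$ and $A_n$ are the state and action at slot $n$. The optimal policy $\pi^*$ is the deterministic stationary policy $\pi^*:\mathcal S\to\{0,1\}$ satisfying $J_{\pi^*}(\delta,S_o)\le J_\pi(\delta,S_o)$ for all history-dependent randomized policies $\pi$.
   Formalization: Optimality for average cost does not determine a unique policy, and some optimal policies have no threshold (the action can be altered at transient states); the claim is stated as existence of an optimal policy with the threshold and bound, and the maximum is read as a supremum. *)

theory Defs
  imports "HOL-Probability.Probability"
begin

text \<open>
  A state (l, k) carries the queue length l and the retransmission number k, so only states with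
  k at least 1 belong to the state space. The sequence q is likewise only relevant at indices at
  least 1; the success probability of the k-th transmission is q k and p k = 1 - q k.
  The actions 0 and 1 are rendered as Continue and Drop.
\<close>

type_synonym state = "nat \<times> nat"

datatype action = Continue | Drop

definition states :: "state set" where
  "states = {(l, k). 1 \<le> k}"

fun transition :: "real \<Rightarrow> (nat \<Rightarrow> real) \<Rightarrow> state \<Rightarrow> action \<Rightarrow> state pmf" where
  "transition lam q (l, k) a =
     bind_pmf (bernoulli_pmf lam) (\<lambda>arrival.
       if l = 0 then return_pmf (of_bool arrival, k)
       else case a of
         Drop \<Rightarrow> return_pmf (l - 1 + of_bool arrival, 1)
       | Continue \<Rightarrow> map_pmf (\<lambda>success.
           if success then (l - 1 + of_bool arrival, 1) else (l + of_bool arrival, k + 1))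
           (bernoulli_pmf (q k)))"

fun cost :: "real \<Rightarrow> (nat \<Rightarrow> real) \<Rightarrow> state \<Rightarrow> action \<Rightarrow> real" where
  "cost delta q (l, k) a =
     (if l = 0 then 0 else real l + (case a of Continue \<Rightarrow> 0 | Drop \<Rightarrow> delta * (1 - q k)))"

text \<open>
  A history-dependent randomized policy maps the past state-action pairs
  (S_1, A_1), ..., (S_{n-1}, A_{n-1}) and the current state S_n to the distribution of A_n.
\<close>

type_synonym policy = "(state \<times> action) list \<Rightarrow> state \<Rightarrow> action pmf"

definition stationary :: "(state \<Rightarrow> action) \<Rightarrow> policy" where
  "stationary f = (\<lambda>h s. return_pmf (f s))"

text \<open>
  The joint law of ([(S_1, A_1), ..., (S_N, A_N)], S_{N+1}) with S_1 = s.
\<close>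

primrec history_pmf ::
  "real \<Rightarrow> (nat \<Rightarrow> real) \<Rightarrow> policy \<Rightarrow> state \<Rightarrow> nat \<Rightarrow> ((state \<times> action) list \<times> state) pmf" where
  "history_pmf lam q \<pi> s 0 = return_pmf ([], s)"
| "history_pmf lam q \<pi> s (Suc N) =
     bind_pmf (history_pmf lam q \<pi> s N) (\<lambda>(h, t).
       bind_pmf (\<pi> h t) (\<lambda>a.
         map_pmf (\<lambda>t'. (h @ [(t, a)], t')) (transition lam q t a)))"

definition expected_total_cost ::
  "real \<Rightarrow> real \<Rightarrow> (nat \<Rightarrow> real) \<Rightarrow> policy \<Rightarrow> state \<Rightarrow> nat \<Rightarrow> real" where
  "expected_total_cost lam delta q \<pi> s N =
     measure_pmf.expectation (history_pmf lam q \<pi> s N)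
       (\<lambda>(h, _). \<Sum>(t, a)\<leftarrow>h. cost delta q t a)"

text \<open>The average cost is an extended real because unstable policies have infinite cost.\<close>

definition average_cost ::
  "real \<Rightarrow> real \<Rightarrow> (nat \<Rightarrow> real) \<Rightarrow> policy \<Rightarrow> state \<Rightarrow> ereal" where
  "average_cost lam delta q \<pi> s =
     limsup (\<lambda>N. ereal (expected_total_cost lam delta q \<pi> s N / real N))"

definition optimal_policy ::
  "real \<Rightarrow> real \<Rightarrow> (nat \<Rightarrow> real) \<Rightarrow> (state \<Rightarrow> action) \<Rightarrow> bool" where
  "optimal_policy lam delta q f \<longleftrightarrow>
     (\<forall>s\<in>states. \<forall>\<pi>.
        average_cost lam delta q (stationary f) s \<le> average_cost lam delta q \<pi> s)"

lemma pmf_transition_continue: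
  assumes "0 \<le> lam" "lam \<le> 1" "0 \<le> q k" "q k \<le> 1" "1 \<le> l" "1 \<le> k"
  shows "pmf (transition lam q (l, k) Continue) (l - 1, 1) = q k * (1 - lam)"
    and "pmf (transition lam q (l, k) Continue) (l, 1) = q k * lam"
    and "pmf (transition lam q (l, k) Continue) (l, k + 1) = (1 - q k) * (1 - lam)"
    and "pmf (transition lam q (l, k) Continue) (l + 1, k + 1) = (1 - q k) * lam"
  using assms by (auto simp: pmf_bind map_pmf_def indicator_def)

lemma pmf_transition_drop:
  assumes "0 \<le> lam" "lam \<le> 1" "1 \<le> l"
  shows "pmf (transition lam q (l, k) Drop) (l - 1, 1) = 1 - lam"
    and "pmf (transition lam q (l, k) Drop) (l, 1) = lam"
  using assms by (auto simp: pmf_bind indicator_def)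

lemma pmf_transition_empty:
  assumes "0 \<le> lam" "lam \<le> 1"
  shows "pmf (transition lam q (0, k) a) (1, k) = lam"
    and "pmf (transition lam q (0, k) a) (0, k) = 1 - lam"
  using assms by (auto simp: pmf_bind indicator_def)

text \<open>
  The history law has finite support, so the expectation above is that of an integrable function.
\<close>

lemma finite_set_history_pmf: "finite (set_pmf (history_pmf lam q \<pi> s N))"
proof (induction N)
  case (Suc N)
  have act: "finite A" for A :: "action set"
    by (rule finite_subset[of _ "{Continue, Drop}"]) (auto intro: action.exhaust)
  have "finite (set_pmf (transition lam q t a))" for t a
    by (cases t; cases a) auto
  with Suc act show ?case
    by (auto split: prod.split)
qed simp

end

theory Submission
  imports Defs
begin

text \<open>
  For lam < 1 the average cost optimality equation is obtained from discounted problems by letting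
  the discount factor tend to 1. In its solution (h, g) an additional packet is worth at least
  g / lam: two coupled queues whose lengths differ by one can share their actions until the shorter
  one is empty, and there the difference is exactly g / lam. Let X be the expected future cost saved by
  dropping instead of retransmitting after a failure at queue length l, so that dropping is optimal
  iff X is at least delta. Unfolding the equation once more and using the bound g / lam yields
  X >= l + lam + p (k+1) * min delta X', where X' is the same quantity one slot later. If
  l + lam > delta * max q, iterating this inequality gives X >= delta. The condition holds for all
  l > b - 1 with b = delta * max q + (1 - lam), hence from the integer part of b on.

  For lam = 1 the queue never shrinks and always dropping is optimal.
\<close>

section \<open>Compactness of pointwise bounded families\<close>

text \<open>Tychonoff: the product of the intervals is compact. The index set is countable, so the
  product topology is first countable and compactness gives sequential compactness.\<close>

lemma pointwise_convergent_subsequence: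
  fixes F :: "nat \<Rightarrow> nat \<times> nat \<Rightarrow> real"
  assumes "\<And>n i. \<bar>F n i\<bar> \<le> C i"
  obtains r G where "strict_mono (r :: nat \<Rightarrow> nat)" "\<And>i. (\<lambda>n. F (r n) i) \<longlonglongrightarrow> G i"
proof -
  define K where "K = Pi\<^sub>E UNIV (\<lambda>i. {- C i..C i})"
  have "compactin (product_topology (\<lambda>i. euclidean) UNIV) K"
    unfolding K_def compactin_PiE by (auto simp: compactin_euclidean_iff)
  then have "compact K" by (simp add: euclidean_product_topology compactin_euclidean_iff)
  then have K: "seq_compact K" by (rule compact_imp_seq_compact)
  have "F n i \<in> {- C i..C i}" for n i using assms[of n i] by auto
  then have "F n \<in> K" for n by (simp add: K_def PiE_iff)
  then obtain G r where r: "strict_mono (r :: nat \<Rightarrow> nat)" and lim: "(F \<circ> r) \<longlonglongrightarrow> G"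
    using seq_compactE[OF K] by metis
  have "(\<lambda>n. F (r n) i) \<longlonglongrightarrow> G i" for i
    using continuous_on_tendsto_compose[OF continuous_on_product_coordinates lim, of i]
    by (simp add: o_def)
  with r show ?thesis by (rule that)
qed

section \<open>Bellman operator and coupling of queue lengths\<close>

text \<open>
  Value functions are written h l j, where the retransmission number of the state is j + 1, and p j
  is the failure probability of transmission j + 1. The term bellman a h m j is the right-hand side
  of the Bellman equation with discount factor a at the state with queue length m + 1.
\<close>
locale queue =
  fixes lam delta :: real and p :: "nat \<Rightarrow> real"
  assumes lam_pos: "0 < lam" and lam_le: "lam \<le> 1" and delta_pos: "0 < delta"
    and p_ge: "0 \<le> p j" and p_le: "p j \<le> 1"
begin

text \<open>The argument \<open>l\<close> is the queue length left after service; the arrival of the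
  slot is averaged afterwards.\<close>

definition arrive :: "(nat \<Rightarrow> nat \<Rightarrow> real) \<Rightarrow> nat \<Rightarrow> nat \<Rightarrow> real" where
  "arrive h l j = (1 - lam) * h l j + lam * h (Suc l) j"

definition bellman :: "real \<Rightarrow> (nat \<Rightarrow> nat \<Rightarrow> real) \<Rightarrow> nat \<Rightarrow> nat \<Rightarrow> real" where
  "bellman a h m j = real (Suc m) +
     min (p j * delta + a * arrive h m 0)
         (a * ((1 - p j) * arrive h m 0 + p j * arrive h (Suc m) (Suc j)))"

lemma arrive_mono:
  assumes "\<And>l. h l j \<le> h' l j"
  shows "arrive h l j \<le> arrive h' l j"
  unfolding arrive_def using lam_pos lam_le assms
  by (intro add_mono mult_left_mono) auto

lemma arrive_lower:
  assumes "c \<le> h l j" "c \<le> h (Suc l) j"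
  shows "c \<le> arrive h l j"
proof -
  have "(1 - lam) * c + lam * c \<le> arrive h l j"
    unfolding arrive_def using lam_pos lam_le assms by (intro add_mono mult_left_mono) auto
  then show ?thesis by (simp add: algebra_simps)
qed

lemma bellman_mono:
  assumes "0 \<le> a" "\<And>l j. h l j \<le> h' l j"
  shows "bellman a h m j \<le> bellman a h' m j"
  unfolding bellman_def using assms p_ge[of j] p_le[of j]
  by (intro add_mono min.mono mult_left_mono arrive_mono) auto

lemma bellman_nonneg:
  assumes "0 \<le> a" "\<And>l j. 0 \<le> h l j"
  shows "0 \<le> bellman a h m j"
proof -
  have "0 \<le> arrive h l j" for l j using assms arrive_lower by blast
  then show ?thesis unfolding bellman_def using assms p_ge[of j] p_le[of j] delta_pos by simp
qed

text \<open>Using the same action at both lengths carries the gap through each branch of the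
  minimum; the additional 1 is the difference of the holding costs.\<close>

lemma bellman_queue_gap:
  assumes "0 \<le> a" and gap: "\<And>l j. h l j + c \<le> h (Suc l) j"
  shows "bellman a h m j + a * c + 1 \<le> bellman a h (Suc m) j"
proof -
  have A: "arrive h l j + c \<le> arrive h (Suc l) j" for l j
  proof -
    have "(1 - lam) * (h l j + c) + lam * (h (Suc l) j + c) \<le> arrive h (Suc l) j"
      unfolding arrive_def using lam_pos lam_le gap by (intro add_mono mult_left_mono) auto
    then show ?thesis by (simp add: arrive_def algebra_simps)
  qed
  have "p j * delta + a * arrive h m 0 + a * c \<le> p j * delta + a * arrive h (Suc m) 0"
    using mult_left_mono[OF A[of m 0] assms(1)] by (simp add: algebra_simps)
  moreover have "a * ((1 - p j) * arrive h m 0 + p j * arrive h (Suc m) (Suc j)) + a * c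
      \<le> a * ((1 - p j) * arrive h (Suc m) 0 + p j * arrive h (Suc (Suc m)) (Suc j))"
  proof -
    have "(1 - p j) * (arrive h m 0 + c) + p j * (arrive h (Suc m) (Suc j) + c)
        \<le> (1 - p j) * arrive h (Suc m) 0 + p j * arrive h (Suc (Suc m)) (Suc j)"
      using p_ge[of j] p_le[of j] by (intro add_mono mult_left_mono A) auto
    from mult_left_mono[OF this assms(1)] show ?thesis by (simp add: algebra_simps)
  qed
  ultimately show ?thesis unfolding bellman_def by (simp add: min_def)
qed

text \<open>The shorter queue simulates the transmission of the longer one and drops exactly when the
  simulation succeeds, which costs at most one dropping penalty.\<close>
lemma bellman_coupling:
  assumes a: "0 \<le> a" "a \<le> 1" and mono: "\<And>l j. h l j \<le> h (Suc l) j"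
    and gap: "\<And>l i j. h (Suc l) j - delta \<le> h (Suc (Suc l)) i"
  shows "bellman a h m j - delta \<le> bellman a h (Suc m) i"
proof -
  define AX BX AY BY where "AX = arrive h (Suc m) 0" and "BX = arrive h (Suc (Suc m)) (Suc i)"
    and "AY = arrive h m 0" and "BY = arrive h (Suc m) (Suc j)"
  have AYX: "AY \<le> AX"
    unfolding AY_def AX_def arrive_def using lam_pos lam_le mono
    by (intro add_mono mult_left_mono) auto
  have G: "arrive h (Suc l) j' - delta \<le> arrive h (Suc (Suc l)) i'" for l i' j'
  proof -
    have "(1 - lam) * (h (Suc l) j' - delta) + lam * (h (Suc (Suc l)) j' - delta)
        \<le> arrive h (Suc (Suc l)) i'"
      unfolding arrive_def using lam_pos lam_le gap by (intro add_mono mult_left_mono) auto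
    then show ?thesis by (simp add: arrive_def algebra_simps)
  qed
  have BB: "BY - delta \<le> BX" unfolding BX_def BY_def by (rule G)
  have BA: "AY - delta \<le> BX" using G[of m 0 "Suc i"] AYX unfolding BX_def AX_def by linarith
  let ?Y = "bellman a h m j"
  have Yd: "?Y \<le> real (Suc m) + (p j * delta + a * AY)"
    and Yc: "?Y \<le> real (Suc m) + a * ((1 - p j) * AY + p j * BY)"
    unfolding bellman_def AY_def BY_def by simp_all
  have pj: "p j * delta \<le> delta" "0 \<le> p j * delta"
    using p_le[of j] p_ge[of j] delta_pos by (simp_all add: mult_left_le_one_le)
  \<comment> \<open>If the longer queue drops, the shorter one drops as well; its penalty is at most
    \<open>delta\<close>.\<close>
  have "?Y - delta \<le> real (Suc (Suc m)) + (p i * delta + a * AX)"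
  proof -
    have "a * AY \<le> a * AX" using a AYX by (intro mult_left_mono)
    moreover have "0 \<le> p i * delta" using p_ge[of i] delta_pos by simp
    ultimately show ?thesis using Yd pj by simp
  qed
  moreover have "?Y - delta \<le> real (Suc (Suc m)) + a * ((1 - p i) * AX + p i * BX)"
  proof -
    \<comment> \<open>The shorter queue randomizes: with weight \<open>1 - p i\<close> (simulated
      success) it drops, with weight \<open>p i\<close> it continues. The amount
      \<open>delta\<close> is lost as a penalty in the first case or through the gap hypothesis in
      the second, never twice.\<close>
    have "(1 - p i) * ?Y + p i * ?Y \<le> (1 - p i) * (real (Suc m) + (p j * delta + a * AY))
        + p i * (real (Suc m) + a * ((1 - p j) * AY + p j * BY))"
      using p_ge[of i] p_le[of i] Yd Yc by (intro add_mono mult_left_mono) auto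
    also have "\<dots> \<le> (1 - p i) * (real (Suc m) + (delta + a * AX))
        + p i * (real (Suc m) + (a * BX + delta))"
    proof -
      have "a * AY \<le> a * AX" using a AYX by (intro mult_left_mono)
      then have drop: "real (Suc m) + (p j * delta + a * AY) \<le> real (Suc m) + (delta + a * AX)"
        using pj by simp
      have "(1 - p j) * AY + p j * BY \<le> (1 - p j) * (BX + delta) + p j * (BX + delta)"
        using BB BA p_ge[of j] p_le[of j] by (intro add_mono mult_left_mono) auto
      then have "a * ((1 - p j) * AY + p j * BY) \<le> a * (BX + delta)"
        using a by (intro mult_left_mono) (simp_all add: algebra_simps)
      also have "\<dots> \<le> a * BX + delta"
        using a delta_pos by (simp add: algebra_simps mult_left_le_one_le)
      finally have continue: "real (Suc m) + a * ((1 - p j) * AY + p j * BY)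
          \<le> real (Suc m) + (a * BX + delta)"
        by simp
      show ?thesis using p_ge[of i] p_le[of i]
        by (intro add_mono[OF mult_left_mono[OF drop] mult_left_mono[OF continue]]) auto
    qed
    finally show ?thesis by (simp add: algebra_simps)
  qed
  ultimately show ?thesis unfolding bellman_def[of a h "Suc m"] AX_def BX_def by simp
qed

section \<open>Discounted problem and value iteration\<close>

text \<open>An idle period has geometric length, so the value at an empty queue is a fixed multiple of
  the value at queue length one.\<close>
definition idle_factor :: "real \<Rightarrow> real" where
  "idle_factor a = a * lam / (1 - a * (1 - lam))"

text \<open>The self-loop of the idle state is already solved, so in each iterate row 0 is
  \<open>idle_factor a\<close> times row 1. As this factor is at most 1, monotonicity between these
  rows is immediate for nonnegative values.\<close>

fun value_step :: "real \<Rightarrow> (nat \<Rightarrow> nat \<Rightarrow> real) \<Rightarrow> nat \<Rightarrow> nat \<Rightarrow> real" where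
  "value_step a h 0 j = idle_factor a * bellman a h 0 j"
| "value_step a h (Suc m) j = bellman a h m j"

primrec value_iter :: "real \<Rightarrow> nat \<Rightarrow> nat \<Rightarrow> nat \<Rightarrow> real" where
  "value_iter a 0 = (\<lambda>l j. 0)"
| "value_iter a (Suc n) = value_step a (value_iter a n)"

lemma idle_denominator_pos:
  assumes "0 < a" "a < 1"
  shows "0 < 1 - a * (1 - lam)"
proof -
  have "a * (1 - lam) \<le> a" using assms lam_pos lam_le by (simp add: mult_left_le)
  then show ?thesis using assms by linarith
qed

lemma idle_factor_bounds:
  assumes "0 < a" "a < 1"
  shows "0 \<le> idle_factor a" "idle_factor a \<le> 1"
  using idle_denominator_pos[OF assms] assms lam_pos
  unfolding idle_factor_def by (auto simp: field_simps)

lemma value_step_mono: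
  assumes "0 < a" "a < 1" "\<And>l j. h l j \<le> h' l j"
  shows "value_step a h l j \<le> value_step a h' l j"
  by (cases l) (use assms idle_factor_bounds in \<open>auto intro!: bellman_mono mult_left_mono\<close>)

lemma value_iter_nonneg:
  assumes "0 < a" "a < 1"
  shows "0 \<le> value_iter a n l j"
proof (induction n arbitrary: l j)
  case (Suc n)
  then show ?case using assms idle_factor_bounds[OF assms] bellman_nonneg[of a]
    by (cases l) auto
qed simp

lemma value_iter_incseq:
  assumes "0 < a" "a < 1"
  shows "value_iter a n l j \<le> value_iter a (Suc n) l j"
proof (induction n arbitrary: l j)
  case 0
  show ?case using value_iter_nonneg[OF assms, of 1] by simp
next
  case (Suc n)
  then show ?case using value_step_mono[OF assms] by simp
qed

lemma value_iter_queue_mono: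
  assumes "0 < a" "a < 1"
  shows "value_iter a n l j \<le> value_iter a n (Suc l) j"
proof (induction n arbitrary: l j)
  case (Suc n)
  show ?case
  proof (cases l)
    case 0
    then show ?thesis using idle_factor_bounds[OF assms] assms bellman_nonneg[of a "value_iter a n" 0 j]
        value_iter_nonneg[OF assms] by (simp add: mult_left_le_one_le)
  next
    case (Suc m)
    then show ?thesis using bellman_queue_gap[of a "value_iter a n" 0 m j] Suc.IH assms by simp
  qed
qed simp

lemma value_iter_gap:
  assumes "0 < a" "a < 1"
  shows "value_iter a n (Suc l) j - delta \<le> value_iter a n (Suc (Suc l)) i"
proof (induction n arbitrary: l i j)
  case 0
  then show ?case using delta_pos by simp
next
  case (Suc n)
  then show ?case
    using bellman_coupling[of a "value_iter a n"] value_iter_queue_mono[OF assms] assms by simp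
qed

text \<open>A linear function \<open>U\<close> is a supersolution, as the drop branch shows, and
  monotonicity of \<open>value_step\<close> keeps the iterates started at 0 below it.\<close>

lemma value_iter_bounded:
  assumes "0 < a" "a < 1"
  shows "value_iter a n l j \<le> (real l + 1 / (1 - a) + delta) / (1 - a)"
proof (induction n arbitrary: l j)
  case 0
  then show ?case using assms delta_pos by simp
next
  case (Suc n)
  \<comment> \<open>The summand \<open>1 / (1 - a)\<close> provides
    \<open>1 \<le> c * (1 - a)\<close> for the empty queue; the summand \<open>delta\<close> pays
    one drop.\<close>
  define c where "c = 1 / (1 - a) + delta"
  define U where "U = (\<lambda>(l::nat) (j::nat). (real l + c) / (1 - a))"
  have c: "delta \<le> c" "1 \<le> c * (1 - a)"
    using assms delta_pos by (simp_all add: c_def distrib_right)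
  have IH: "value_iter a n l j \<le> U l j" for l j using Suc.IH[of l j] by (simp add: U_def c_def add.assoc)
  have B: "bellman a U m j \<le> (real (Suc m) + c) / (1 - a)" for m
  proof -
    have "arrive U m 0 = (real m + lam + c) / (1 - a)"
      by (simp add: arrive_def U_def divide_inverse algebra_simps)
    also have "\<dots> \<le> (real (Suc m) + c) / (1 - a)"
      using assms lam_le by (intro divide_right_mono) auto
    finally have "a * arrive U m 0 \<le> a * ((real (Suc m) + c) / (1 - a))"
      using assms by (intro mult_left_mono) auto
    moreover have "p j * delta \<le> delta" using p_le[of j] p_ge delta_pos by (simp add: mult_left_le_one_le)
    ultimately have "bellman a U m j \<le> real (Suc m) + c + a * ((real (Suc m) + c) / (1 - a))"
      unfolding bellman_def using c by linarith
    also have "\<dots> = (real (Suc m) + c) / (1 - a)" using assms by (simp add: field_simps)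
    finally show ?thesis .
  qed
  have "value_step a U l j \<le> U l j"
  proof (cases l)
    case 0
    have "idle_factor a * (1 + c) \<le> c"
    proof -
      have "a * lam * (1 + c) \<le> c * (1 - a * (1 - lam))"
      proof -
        have "a * lam \<le> 1" using assms lam_le lam_pos by (simp add: mult_le_one)
        then show ?thesis using c(2) by (simp add: algebra_simps)
      qed
      then show ?thesis using idle_denominator_pos[OF assms]
        by (simp add: idle_factor_def pos_divide_le_eq)
    qed
    moreover have "idle_factor a * bellman a U 0 j \<le> idle_factor a * ((1 + c) / (1 - a))"
      using B[of 0] idle_factor_bounds[OF assms] by (intro mult_left_mono) auto
    moreover have "idle_factor a * ((1 + c) / (1 - a)) \<le> c / (1 - a)"
      using calculation(1) assms by (simp add: divide_right_mono)
    ultimately show ?thesis using 0 by (simp add: U_def)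
  next
    case (Suc m)
    then show ?thesis using B[of m] by (simp add: U_def)
  qed
  then have "value_step a (value_iter a n) l j \<le> U l j"
    by (rule order_trans[OF value_step_mono[OF assms IH]])
  then show ?case by (simp add: U_def c_def add.assoc)
qed

text \<open>The iterates increase and are bounded, hence converge pointwise. Each equation is
  continuous in finitely many values, so it passes to the limit, as do the inequalities.\<close>

lemma discounted_value:
  assumes a: "0 < a" "a < 1"
  obtains V where "\<And>j. V 0 j = a * arrive V 0 j" "\<And>m j. V (Suc m) j = bellman a V m j"
    "\<And>l j. 0 \<le> V l j" "\<And>l j. V l j \<le> V (Suc l) j"
    "\<And>l i j. V (Suc l) j - delta \<le> V (Suc (Suc l)) i"
proof -
  define V where "V l j = lim (\<lambda>n. value_iter a n l j)" for l j
  have lim: "(\<lambda>n. value_iter a n l j) \<longlonglongrightarrow> V l j" for l j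
  proof -
    have "incseq (\<lambda>n. value_iter a n l j)" using value_iter_incseq[OF a] by (rule incseq_SucI)
    moreover have "\<forall>n. value_iter a n l j \<le> (real l + 1 / (1 - a) + delta) / (1 - a)"
      using value_iter_bounded[OF a] by blast
    ultimately obtain L where "(\<lambda>n. value_iter a n l j) \<longlonglongrightarrow> L"
      by (rule incseq_convergent)
    then show ?thesis unfolding V_def by (metis limI)
  qed
  have blim: "(\<lambda>n. bellman a (value_iter a n) m j) \<longlonglongrightarrow> bellman a V m j" for m j
    unfolding bellman_def arrive_def by (intro tendsto_intros lim)
  have S: "V (Suc m) j = bellman a V m j" for m j
    using LIMSEQ_unique[OF LIMSEQ_Suc[OF lim[of "Suc m" j]]] blim by simp
  have "V 0 j = idle_factor a * bellman a V 0 j" for j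
    using LIMSEQ_unique[OF LIMSEQ_Suc[OF lim[of 0 j]]] tendsto_mult_left[OF blim] by simp
  then have "V 0 j = idle_factor a * V 1 j" for j using S by simp
  then have Z: "V 0 j = a * arrive V 0 j" for j
    using idle_denominator_pos[OF a] by (simp add: idle_factor_def arrive_def field_simps)
  show ?thesis
  proof (rule that[of V, OF Z S])
    show "0 \<le> V l j" for l j
      by (rule LIMSEQ_le_const[OF lim]) (use value_iter_nonneg[OF a] in auto)
    show "V l j \<le> V (Suc l) j" for l j
      by (rule LIMSEQ_le[OF lim lim]) (use value_iter_queue_mono[OF a] in auto)
    show "V (Suc l) j - delta \<le> V (Suc (Suc l)) i" for l i j
      by (rule LIMSEQ_le[OF tendsto_diff[OF lim tendsto_const] lim])
        (use value_iter_gap[OF a] in auto)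
  qed
qed

section \<open>Relative values, bounded uniformly in the discount factor\<close>

lemma arrive_diff: "arrive (\<lambda>l j. h l j - c) l j = arrive h l j - c"
  by (simp add: arrive_def algebra_simps)

lemma bellman_diff: "bellman a (\<lambda>l j. h l j - c) m j = bellman a h m j - a * c"
  by (simp add: bellman_def arrive_diff algebra_simps min_diff_distrib_left)

text \<open>An envelope free of the discount factor, as compactness requires. It is quadratic in the
  queue length because it sums the holding costs of clearing the queue by drops.\<close>

definition relative_bound :: "nat \<Rightarrow> real" where
  "relative_bound l = 2 * (real l + 1 + delta) * (real l + 1) / (1 - lam)"

text \<open>Here \<open>h\<close> is the discounted value minus its value \<open>V 0 0\<close>. The
  gain \<open>(1 - a) * V 0 0\<close> is expressed through \<open>h\<close> so that it converges
  together with \<open>h\<close>. Always dropping bounds \<open>h\<close> from above; holding costs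
  and coupling bound it from below.\<close>

lemma relative_discounted_value:
  assumes "lam < 1" and a: "0 < a" "a < 1"
  obtains h where "\<And>j. h 0 j + a * lam * (h 1 0 - h 0 0) = a * arrive h 0 j"
    "\<And>m j. h (Suc m) j + a * lam * (h 1 0 - h 0 0) = bellman a h m j"
    "\<And>l j. h l j \<le> h (Suc l) j" "\<And>l i. h l 0 - delta \<le> h (Suc l) i"
    "\<And>l j. \<bar>h l j\<bar> \<le> relative_bound l"
    "\<And>l j. - relative_bound 0 \<le> h l j"
proof -
  obtain V where Z: "\<And>j. V 0 j = a * arrive V 0 j" and S: "\<And>m j. V (Suc m) j = bellman a V m j"
    and nonneg: "\<And>l j. 0 \<le> V l j" and mono: "\<And>l j. V l j \<le> V (Suc l) j"
    and gap: "\<And>l i j. V (Suc l) j - delta \<le> V (Suc (Suc l)) i"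
    using discounted_value[OF a] by blast
  define h where "h = (\<lambda>l j. V l j - V 0 0)"
  have anonneg: "0 \<le> arrive V l j" for l j using nonneg by (intro arrive_lower)
  have amono: "arrive V l j \<le> V (Suc l) j" for l j
  proof -
    have "arrive V l j \<le> (1 - lam) * V (Suc l) j + lam * V (Suc l) j"
      unfolding arrive_def using lam_pos lam_le mono by (intro add_mono mult_left_mono) auto
    then show ?thesis by (simp add: algebra_simps)
  qed
  have drop: "V (Suc m) j \<le> real (Suc m) + delta + a * arrive V m 0" for m j
  proof -
    have "p j * delta \<le> delta" using p_le[of j] p_ge delta_pos by (simp add: mult_left_le_one_le)
    then show ?thesis unfolding S bellman_def by linarith
  qed
  have aV: "a * arrive V m 0 \<le> arrive V m 0" for m
    using a anonneg by (simp add: mult_left_le_one_le)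
  \<comment> \<open>A drop at length \<open>Suc m\<close> leads to \<open>m\<close> with probability
    \<open>1 - lam\<close>, so the inequality can be solved for the increment when
    \<open>lam < 1\<close>.\<close>
  have step: "V (Suc m) 0 - V m 0 \<le> (real (Suc m) + delta) / (1 - lam)" for m
  proof -
    have "V (Suc m) 0 \<le> real (Suc m) + delta + arrive V m 0" using drop[of m 0] aV[of m] by linarith
    then have "(1 - lam) * (V (Suc m) 0 - V m 0) \<le> real (Suc m) + delta"
      by (simp add: arrive_def algebra_simps)
    then show ?thesis using assms(1) by (simp add: pos_le_divide_eq mult.commute)
  qed
  have up0: "h l 0 \<le> real l * ((real l + delta) / (1 - lam))" for l
  proof (induction l)
    case (Suc l)
    have "h (Suc l) 0 \<le> h l 0 + (real (Suc l) + delta) / (1 - lam)"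
      using step[of l] by (simp add: h_def)
    also have "real l * ((real l + delta) / (1 - lam)) \<le> real l * ((real (Suc l) + delta) / (1 - lam))"
      using assms(1) by (intro mult_left_mono divide_right_mono) auto
    then have "h l 0 + (real (Suc l) + delta) / (1 - lam)
        \<le> (real l + 1) * ((real (Suc l) + delta) / (1 - lam))"
      using Suc unfolding distrib_right by linarith
    finally show ?case by (simp add: add.commute)
  qed (simp add: h_def)
  have upS: "h (Suc l) j \<le> real (Suc l) + delta + real (Suc l) * ((real (Suc l) + delta) / (1 - lam))"
    for l j
    using drop[of l j] aV[of l] amono[of l 0] up0[of "Suc l"] by (simp add: h_def)
  have idle: "V 0 j = idle_factor a * V 1 j" for j
    using Z[of j] idle_denominator_pos[OF a] by (simp add: idle_factor_def arrive_def field_simps)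
  have RB: "real (Suc l) + delta + real (Suc l) * ((real (Suc l) + delta) / (1 - lam))
      \<le> relative_bound l" for l
  proof -
    define s where "s = (real (Suc l) + delta) / (1 - lam)"
    define t where "t = real (Suc l) * s"
    have "real (Suc l) + delta \<le> s"
      using assms(1) lam_pos delta_pos by (simp add: s_def pos_le_divide_eq mult_left_le)
    moreover have "s \<le> t"
      using assms(1) delta_pos mult_right_mono[of 1 "real (Suc l)" s] by (simp add: s_def t_def)
    moreover have "relative_bound l = 2 * t"
      by (simp add: relative_bound_def s_def t_def algebra_simps)
    ultimately show ?thesis unfolding s_def[symmetric] t_def[symmetric] by linarith
  qed
  have upper: "h l j \<le> relative_bound l" for l j
  proof -
    have "h l j \<le> h (Suc l) j" using mono by (simp add: h_def)
    then show ?thesis using upS[of l j] RB[of l] by linarith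
  qed
  have low1: "V 0 0 - delta \<le> V 1 j" for j
  proof -
    \<comment> \<open>The start is the trivial bound \<open>0 \<le> V 1 j\<close>. Each unfolding of
      the Bellman equation pays holding cost 1, so the possible deficit below \<open>V 0 0\<close>
      shrinks by 1 until it reaches \<open>delta\<close>.\<close>
    have "- max delta (V 0 0 - real n) \<le> V 1 j - V 0 0" for n
    proof (induction n arbitrary: j)
      case 0
      then show ?case using nonneg[of 1 j] by simp
    next
      case (Suc n)
      define c where "c = max delta (V 0 0 - real n)"
      have c: "delta \<le> c" "c - 1 \<le> max delta (V 0 0 - real (Suc n))" by (auto simp: c_def)
      define B where "B = arrive V 1 (Suc j) - arrive V 0 0"
      have "- c \<le> B"
      proof -
        have "- c \<le> (1 - lam) * (V 1 (Suc j) - V 0 0) + lam * (V 2 (Suc j) - V 1 0)"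
        proof -
          have "- delta \<le> V 2 (Suc j) - V 1 0" using gap[of 0 0 "Suc j"] by (simp add: numeral_2_eq_2)
          then have "- c \<le> V 2 (Suc j) - V 1 0" using c by linarith
          then have "(1 - lam) * (- c) + lam * (- c) \<le> (1 - lam) * (V 1 (Suc j) - V 0 0)
              + lam * (V 2 (Suc j) - V 1 0)"
            using lam_pos lam_le Suc[of "Suc j"] by (intro add_mono mult_left_mono) (auto simp: c_def)
          then show ?thesis by (simp add: algebra_simps)
        qed
        then show ?thesis by (simp add: B_def arrive_def algebra_simps numeral_2_eq_2)
      qed
      then have "- (a * c) \<le> a * B" using a mult_left_mono[of "- c" B a] by simp
      moreover have "a * c \<le> c" using a c delta_pos by (simp add: mult_left_le_one_le)
      ultimately have aB: "- c \<le> a * B" by linarith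
      have "- c \<le> p j * (- c)" using p_ge[of j] p_le[of j] c delta_pos by (simp add: mult_left_le_one_le)
      also have "\<dots> \<le> p j * min delta (a * B)"
        using p_ge aB c delta_pos by (intro mult_left_mono) auto
      \<comment> \<open>By the idle equation \<open>a * arrive V 0 0\<close> is
        \<open>V 0 0\<close>; both branches of the minimum share this term, and \<open>p j\<close>
        factors out of the rest.\<close>
      also have "\<dots> = V 1 j - 1 - V 0 0"
        using S[of 0 j] Z[of 0] p_ge[of j]
        by (simp add: bellman_def B_def algebra_simps min_mult_distrib_left min_add_distrib_left)
      finally show ?case using c by simp
    qed
    note bound = this
    obtain n where "V 0 0 \<le> real n" using real_arch_simple by blast
    then have "max delta (V 0 0 - real n) = delta" using delta_pos by simp
    then show ?thesis using bound[of n] by simp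
  qed
  have low: "h l 0 - delta \<le> h (Suc l) i" for l i
    using low1[of i] gap[of "l - 1" 0 i] by (cases l) (auto simp: h_def)
  \<comment> \<open>An empty queue keeps its retransmission number, so differences within row 0 are
    those of row 1 scaled by \<open>idle_factor a\<close>.\<close>
  have low0: "- relative_bound 0 \<le> h 0 j" for j
  proof -
    have "idle_factor a * (V 1 0 - V 1 j) \<le> relative_bound 0"
    proof -
      have "V 1 0 - V 1 j \<le> relative_bound 0"
        using low1[of j] up0[of 1] RB[of 0] delta_pos by (simp add: h_def)
      moreover have "0 \<le> relative_bound 0"
        using assms(1) delta_pos by (simp add: relative_bound_def)
      ultimately show ?thesis using idle_factor_bounds[OF a]
        by (meson mult_left_le_one_le mult_left_mono order_trans)
    qed
    then show ?thesis using idle[of 0] idle[of j] by (simp add: h_def algebra_simps)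
  qed
  have pos0: "delta \<le> relative_bound 0" using RB[of 0] assms(1) delta_pos
    by (smt (verit) divide_nonneg_pos mult_nonneg_nonneg of_nat_0_le_iff)
  have lower: "- relative_bound 0 \<le> h l j" for l j
  proof (cases l)
    case 0
    then show ?thesis using low0 by simp
  next
    case (Suc m)
    have "V 0 0 \<le> V m 0" by (rule lift_Suc_mono_le[of "\<lambda>l. V l 0"]) (use mono in auto)
    then show ?thesis using Suc low[of m j] pos0 by (simp add: h_def)
  qed
  have rbm: "relative_bound 0 \<le> relative_bound l" for l
    unfolding relative_bound_def using assms(1) delta_pos by (intro divide_right_mono mult_mono) auto
  have gain: "a * lam * (h 1 0 - h 0 0) = (1 - a) * V 0 0"
    using Z[of 0] by (simp add: h_def arrive_def algebra_simps)
  show ?thesis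
  proof (rule that[of h])
    show "h 0 j + a * lam * (h 1 0 - h 0 0) = a * arrive h 0 j" for j
      unfolding gain using Z[of j] unfolding h_def arrive_diff by (simp add: algebra_simps)
    show "h (Suc m) j + a * lam * (h 1 0 - h 0 0) = bellman a h m j" for m j
      unfolding gain using S[of m j] unfolding h_def bellman_diff by (simp add: algebra_simps)
    show "h l j \<le> h (Suc l) j" for l j using mono by (simp add: h_def)
    show "\<bar>h l j\<bar> \<le> relative_bound l" for l j
      using upper[of l j] lower[of l j] rbm[of l] by linarith
  qed (use low lower in auto)
qed

section \<open>The vanishing discount limit\<close>

text \<open>The relative values for discount factors tending to 1 lie in a fixed product of
  intervals, so a subsequence converges pointwise. Every equation and inequality involves finitely
  many values and survives the limit.\<close>

lemma average_cost_optimality_equation: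
  assumes "lam < 1"
  obtains h g C where "\<And>j. h 0 j + g = arrive h 0 j" "\<And>m j. h (Suc m) j + g = bellman 1 h m j"
    "\<And>l j. h l j \<le> h (Suc l) j" "\<And>l i. h l 0 - delta \<le> h (Suc l) i" "\<And>l j. C \<le> h l j"
proof -
  \<comment> \<open>The shift by 2 makes \<open>a 0\<close> equal to 1/2, so every factor lies
    strictly between 0 and 1.\<close>
  define a where "a n = 1 - 1 / (real n + 2)" for n :: nat
  have a: "0 < a n" "a n < 1" for n by (auto simp: a_def field_simps)
  have alim: "a \<longlonglongrightarrow> 1" unfolding a_def by real_asymp
  define good where "good n h \<longleftrightarrow>
    (\<forall>j. h 0 j + a n * lam * (h 1 0 - h 0 0) = a n * arrive h 0 j)
    \<and> (\<forall>m j. h (Suc m) j + a n * lam * (h 1 0 - h 0 0) = bellman (a n) h m j)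
    \<and> (\<forall>l j. h l j \<le> h (Suc l) j) \<and> (\<forall>l i. h l 0 - delta \<le> h (Suc l) i)
    \<and> (\<forall>l j. \<bar>h l j\<bar> \<le> relative_bound l) \<and> (\<forall>l j. - relative_bound 0 \<le> h l j)" for n h
  have "\<exists>h. good n h" for n
  proof (rule relative_discounted_value[OF assms a[of n]])
    fix h
    assume "\<And>j. h 0 j + a n * lam * (h 1 0 - h 0 0) = a n * arrive h 0 j"
      "\<And>m j. h (Suc m) j + a n * lam * (h 1 0 - h 0 0) = bellman (a n) h m j"
      "\<And>l j. h l j \<le> h (Suc l) j" "\<And>l i. h l 0 - delta \<le> h (Suc l) i"
      "\<And>l j. \<bar>h l j\<bar> \<le> relative_bound l" "\<And>l j. - relative_bound 0 \<le> h l j"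
    then have "good n h" unfolding good_def by (intro conjI allI)
    then show "\<exists>h. good n h" by blast
  qed
  then obtain H where H: "\<And>n. good n (H n)" using choice[of good] by blast
  note Z = H[unfolded good_def, THEN conjunct1, rule_format]
    and S = H[unfolded good_def, THEN conjunct2, THEN conjunct1, rule_format]
    and mono = H[unfolded good_def, THEN conjunct2, THEN conjunct2, THEN conjunct1, rule_format]
    and low = H[unfolded good_def, THEN conjunct2, THEN conjunct2, THEN conjunct2, THEN conjunct1,
      rule_format]
    and bnd = H[unfolded good_def, THEN conjunct2, THEN conjunct2, THEN conjunct2, THEN conjunct2,
      THEN conjunct1, rule_format]
    and lower = H[unfolded good_def, THEN conjunct2, THEN conjunct2, THEN conjunct2, THEN conjunct2,
      THEN conjunct2, rule_format]
  obtain r G where r: "strict_mono r" and G: "\<And>i. (\<lambda>n. case_prod (H (r n)) i) \<longlonglongrightarrow> G i"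
    using pointwise_convergent_subsequence[of "\<lambda>n. case_prod (H n)" "\<lambda>i. relative_bound (fst i)"] bnd
    by (auto simp: case_prod_beta)
  define h where "h = curry G"
  have lim: "(\<lambda>n. H (r n) l j) \<longlonglongrightarrow> h l j" for l j using G[of "(l, j)"] by (simp add: h_def)
  have ar: "(\<lambda>n. a (r n)) \<longlonglongrightarrow> 1"
    using LIMSEQ_subseq_LIMSEQ[OF alim r] by (simp add: o_def)
  define g where "g = 1 * lam * (h 1 0 - h 0 0)"
  show ?thesis
  proof (rule that[of h g "- relative_bound 0"])
    show "h 0 j + g = arrive h 0 j" for j
    proof -
      have "(\<lambda>n. H (r n) 0 j + a (r n) * lam * (H (r n) 1 0 - H (r n) 0 0)) \<longlonglongrightarrow> h 0 j + g"
        unfolding g_def by (intro tendsto_intros lim ar)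
      moreover have "(\<lambda>n. a (r n) * arrive (H (r n)) 0 j) \<longlonglongrightarrow> 1 * arrive h 0 j"
        unfolding arrive_def by (intro tendsto_intros lim ar)
      ultimately have "h 0 j + g = 1 * arrive h 0 j" unfolding Z by (rule LIMSEQ_unique)
      then show ?thesis by simp
    qed
    show "h (Suc m) j + g = bellman 1 h m j" for m j
    proof -
      have "(\<lambda>n. H (r n) (Suc m) j + a (r n) * lam * (H (r n) 1 0 - H (r n) 0 0)) \<longlonglongrightarrow> h (Suc m) j + g"
        unfolding g_def by (intro tendsto_intros lim ar)
      moreover have "(\<lambda>n. bellman (a (r n)) (H (r n)) m j) \<longlonglongrightarrow> bellman 1 h m j"
        unfolding arrive_def bellman_def by (intro tendsto_intros lim ar)
      ultimately show ?thesis unfolding S by (rule LIMSEQ_unique)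
    qed
    show "h l j \<le> h (Suc l) j" for l j by (rule LIMSEQ_le[OF lim lim]) (use mono in auto)
    show "h l 0 - delta \<le> h (Suc l) i" for l i
      by (rule LIMSEQ_le[OF tendsto_diff[OF lim tendsto_const] lim]) (use low in auto)
    show "- relative_bound 0 \<le> h l j" for l j
      by (rule LIMSEQ_le_const[OF lim]) (use lower in auto)
  qed
qed

end

section \<open>Drop threshold from the optimality equation\<close>

locale optimality_equation = queue +
  fixes h :: "nat \<Rightarrow> nat \<Rightarrow> real" and g :: real
  assumes lam_less: "lam < 1"
    and empty_eq: "h 0 j + g = arrive h 0 j"
    and busy_eq: "h (Suc m) j + g = bellman 1 h m j"
    and queue_mono: "h l j \<le> h (Suc l) j"
    and drop_gap: "h l 0 - delta \<le> h (Suc l) i"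
begin

text \<open>The quantity X of the overview at queue length \<open>Suc m\<close>, after a failure of
  transmission \<open>j + 1\<close>.\<close>

definition excess :: "nat \<Rightarrow> nat \<Rightarrow> real" where
  "excess m j = arrive h (Suc m) (Suc j) - arrive h m 0"

text \<open>Both branches contain \<open>arrive h m 0\<close>, and what remains is weighted by the
  failure probability. Dropping attains the minimum once
  \<open>delta \<le> excess m j\<close>.\<close>

lemma busy_eq_excess:
  "h (Suc m) j + g = real (Suc m) + arrive h m 0 + p j * min delta (excess m j)"
  unfolding busy_eq bellman_def excess_def min_mult_distrib_left
  using p_ge[of j] by (simp add: min_def algebra_simps)

text \<open>Two coupled queues of lengths l + 1 and l evolve in parallel until the shorter one is empty,
  where the value difference is exactly g / lam.\<close>
lemma marginal_value: "g \<le> lam * (h (Suc l) j - h l j)"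
proof -
  \<comment> \<open>Each unfolding adds one unit of holding cost to the difference, so after
    \<open>n\<close> slots it is at least \<open>n\<close>, or at least \<open>g / lam\<close> if
    the shorter queue has emptied.\<close>
  have gap: "h l j + min (real n) (g / lam) \<le> h (Suc l) j" for n l j
  proof (induction n arbitrary: l j)
    case 0
    then show ?case using queue_mono[of l j] by (simp add: min_def)
  next
    case (Suc n)
    show ?case
    proof (cases l)
      case 0
      have "h 1 j - h 0 j = g / lam"
        using empty_eq[of j] lam_pos by (simp add: arrive_def field_simps)
      then show ?thesis using 0 by simp
    next
      case (Suc m)
      have "bellman 1 h m j + min (real n) (g / lam) + 1 \<le> bellman 1 h (Suc m) j"
        using bellman_queue_gap[of 1 h "min (real n) (g / lam)" m j] Suc.IH by simp
      then show ?thesis using Suc busy_eq[of m j] busy_eq[of "Suc m" j] by simp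
    qed
  qed
  obtain n where "g / lam \<le> real n" using real_arch_simple by blast
  then have "g / lam \<le> h (Suc l) j - h l j" using gap[of l j n] by simp
  then show ?thesis using lam_pos by (simp add: pos_divide_le_eq mult.commute)
qed

text \<open>Averaging \<open>drop_gap\<close> over the arrival gives this starting value for the
  iteration in \<open>excess_ge_delta\<close>.\<close>

lemma excess_lower: "- delta \<le> excess m j"
proof -
  have "(1 - lam) * (h m 0 - delta) + lam * (h (Suc m) 0 - delta) \<le> arrive h (Suc m) (Suc j)"
    unfolding arrive_def using lam_pos lam_le drop_gap by (intro add_mono mult_left_mono) auto
  then show ?thesis by (simp add: excess_def arrive_def algebra_simps)
qed

text \<open>The excess averages \<open>h (Suc m) (Suc j) - h m 0\<close> over the arrival. Expanding
  the first term by the optimality equation leaves the surplus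
  \<open>lam * (h (Suc m) 0 - h m 0) - g\<close>, which is nonnegative by
  \<open>marginal_value\<close>.\<close>

lemma excess_step:
  "(1 - lam) * (real (Suc m) + p (Suc j) * min delta (excess m (Suc j)))
    + lam * (real (Suc (Suc m)) + p (Suc j) * min delta (excess (Suc m) (Suc j))) \<le> excess m j"
proof -
  have gap: "real (Suc m) + p (Suc j) * min delta (excess m (Suc j)) \<le> h (Suc m) (Suc j) - h m 0" for m
    using busy_eq_excess[of m "Suc j"] marginal_value[of m 0] by (simp add: arrive_def algebra_simps)
  have "(1 - lam) * (real (Suc m) + p (Suc j) * min delta (excess m (Suc j)))
      + lam * (real (Suc (Suc m)) + p (Suc j) * min delta (excess (Suc m) (Suc j)))
      \<le> (1 - lam) * (h (Suc m) (Suc j) - h m 0) + lam * (h (Suc (Suc m)) (Suc j) - h (Suc m) 0)"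
    using lam_pos lam_le by (intro add_mono mult_left_mono gap) auto
  also have "\<dots> = excess m j" by (simp add: excess_def arrive_def algebra_simps)
  finally show ?thesis .
qed

text \<open>If \<open>x \<le> delta\<close> bounds the excess from below, \<open>excess_step\<close>
  improves the bound to \<open>delta * (1 - p (Suc j)) + e + p (Suc j) * x\<close>, which is at
  least \<open>x + e\<close>. The bound climbs by \<open>e\<close> per round until it is capped at
  \<open>delta\<close>.\<close>

lemma excess_ge_delta:
  assumes "0 < e" and thr: "\<And>j. delta * (1 - p (Suc j)) + e \<le> real (Suc m0) + lam" and "m0 \<le> m"
  shows "delta \<le> excess m j"
proof -
  have bound: "min delta (real n * e - delta) \<le> excess m j" if "m0 \<le> m" for n m j
    using that
  proof (induction n arbitrary: m j)
    case 0
    then show ?case using excess_lower[of m j] delta_pos by simp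
  next
    case (Suc n)
    define x where "x = min delta (real n * e - delta)"
    let ?p = "p (Suc j)"
    have le: "?p * x \<le> ?p * min delta (excess m (Suc j))"
      "?p * x \<le> ?p * min delta (excess (Suc m) (Suc j))"
      using Suc.IH[of m "Suc j"] Suc.IH[of "Suc m" "Suc j"] Suc.prems p_ge[of "Suc j"]
      by (auto simp: x_def intro!: mult_left_mono)
    have "(1 - lam) * (real (Suc m) + ?p * x) + lam * (real (Suc (Suc m)) + ?p * x)
        \<le> (1 - lam) * (real (Suc m) + ?p * min delta (excess m (Suc j)))
          + lam * (real (Suc (Suc m)) + ?p * min delta (excess (Suc m) (Suc j)))"
      using lam_pos lam_le
      by (intro add_mono[OF mult_left_mono[OF add_left_mono[OF le(1)]]
            mult_left_mono[OF add_left_mono[OF le(2)]]]) auto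
    also have "\<dots> \<le> excess m j" by (rule excess_step)
    finally have "real (Suc m) + lam + ?p * x \<le> excess m j" by (simp add: algebra_simps)
    moreover have "delta * (1 - ?p) + e \<le> real (Suc m) + lam" using thr[of j] Suc.prems by simp
    moreover have "x * (1 - ?p) \<le> delta * (1 - ?p)"
      using p_le[of "Suc j"] by (intro mult_right_mono) (auto simp: x_def)
    ultimately have "x + e \<le> excess m j" by (simp add: algebra_simps)
    then show ?case using assms(1) by (auto simp: x_def algebra_simps min_def split: if_splits)
  qed
  \<comment> \<open>The climb leads from \<open>- delta\<close> to \<open>delta\<close> in
    increments of \<open>e\<close>.\<close>
  obtain n where "2 * delta / e \<le> real n" using real_arch_simple by blast
  then have "delta \<le> real n * e - delta" using assms(1) by (simp add: pos_divide_le_eq)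
  then show ?thesis using bound[OF assms(3), of n j] by simp
qed

section \<open>A subsolution of linear growth\<close>

text \<open>The value function grows quadratically; replacing it by a tangent line beyond K keeps the
  optimality inequality and makes the growth linear.\<close>
lemma linear_subsolution:
  assumes drop: "\<And>m j. m0 \<le> m \<Longrightarrow> delta \<le> excess m j"
  obtains u c where "\<And>j. u 0 j + g \<le> arrive u 0 j" "\<And>m j. u (Suc m) j + g \<le> bellman 1 u m j"
    "0 < c" "\<And>l j. u l j \<le> c * (1 + real l)"
proof -
  \<comment> \<open>The term \<open>2 * delta\<close> makes the slope \<open>d\<close> at least
    \<open>2 * delta\<close>, so that dropping attains the minimum for \<open>u\<close> beyond
    \<open>K\<close>.\<close>
  obtain n where n: "g + 2 * delta \<le> real n" using real_arch_simple by blast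
  define m1 where "m1 = max m0 n"
  define K where "K = Suc m1"
  define d where "d = h K 0 - h m1 0"
  have K: "g + 2 * delta \<le> real K" "m0 \<le> m1" using n by (auto simp: K_def m1_def)
  \<comment> \<open>The correction \<open>delta * (p j - p 0)\<close> is the exact dependence of
    \<open>h\<close> on the retransmission index where dropping is optimal. Linear growth lets the
    expected queue length control the expectation of \<open>u\<close>.\<close>
  define u where "u l j = (if l \<le> K then h l j else h K 0 + (real l - real K) * d + delta * (p j - p 0))"
    for l j
  have hK: "h (Suc m) j + g = real (Suc m) + arrive h m 0 + p j * delta" if "m0 \<le> m" for m j
    using busy_eq_excess[of m j] drop[OF that, of j] by simp
  have d: "(1 - lam) * d = real K + delta * p 0 - g"
    using hK[OF K(2), of 0] by (simp add: d_def K_def arrive_def algebra_simps)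
  have d_ge: "2 * delta \<le> d"
  proof -
    have dp: "0 \<le> delta * p 0" using p_ge delta_pos by simp
    then have "2 * delta \<le> (1 - lam) * d" using d K(1) by linarith
    then have "0 < (1 - lam) * d" using delta_pos by linarith
    then have "0 < d" using lam_less by (simp add: zero_less_mult_iff)
    then have "(1 - lam) * d \<le> d" using lam_pos by (simp add: algebra_simps)
    then show ?thesis using \<open>2 * delta \<le> (1 - lam) * d\<close> by linarith
  qed
  have hKj: "h K j = h K 0 + delta * (p j - p 0)" for j
    using hK[OF K(2), of 0] hK[OF K(2), of j] by (simp add: K_def algebra_simps)
  have uK: "u l j = h K 0 + (real l - real K) * d + delta * (p j - p 0)" if "K \<le> l" for l j
    using that hKj[of j] by (auto simp: u_def)
  \<comment> \<open>As \<open>d\<close> is a secant slope, the linear formula already holds at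
    \<open>m1 = K - 1\<close>, a length reached by a drop from \<open>K\<close>.\<close>
  have u0: "u l 0 = h K 0 + (real l - real K) * d" if "m1 \<le> l" for l
  proof (cases "l = m1")
    case True
    then show ?thesis by (simp add: u_def K_def d_def)
  next
    case False
    then show ?thesis using that uK[of l 0] by (simp add: K_def)
  qed
  have uh: "arrive u l j = arrive h l j" if "l < K" for l j using that by (simp add: arrive_def u_def)
  show ?thesis
  proof (rule that[of u "\<bar>h K 0\<bar> + d + delta"])
    show "u 0 j + g \<le> arrive u 0 j" for j
      using empty_eq[of j] uh[of 0] by (simp add: u_def K_def)
    show "u (Suc m) j + g \<le> bellman 1 u m j" for m j
    proof (cases "Suc m < K")
      case True
      then show ?thesis using busy_eq[of m j] uh[of m] uh[of "Suc m"] by (simp add: bellman_def u_def)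
    next
      case False
      then have m: "K \<le> Suc m" "m1 \<le> m" by (auto simp: K_def)
      define A where "A = arrive u m 0"
      define B where "B = arrive u (Suc m) (Suc j)"
      have A: "A = h K 0 + (real m + lam - real K) * d"
        unfolding A_def arrive_def u0[OF m(2)] u0[OF le_SucI[OF m(2)]] by (simp add: algebra_simps)
      have B: "B = h K 0 + (real (Suc m) + lam - real K) * d + delta * (p (Suc j) - p 0)"
        unfolding B_def arrive_def uK[OF m(1)] uK[OF le_SucI[OF m(1)]] by (simp add: algebra_simps)
      have "delta * p 0 \<le> delta" "0 \<le> delta * p (Suc j)"
        using p_le[of 0] p_ge[of "Suc j"] delta_pos by (auto simp: mult_left_le)
      then have AB: "A + delta \<le> B" using d_ge by (simp add: A B algebra_simps)
      have "u (Suc m) j + g = h K 0 + (real (Suc m) - real K) * d + delta * (p j - p 0) + g"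
        using uK[OF m(1)] by simp
      also have "\<dots> = real K + A + p j * delta" using d by (simp add: A algebra_simps)
      \<comment> \<open>The tangent line accounts for holding cost \<open>K\<close> only, and the
        true cost \<open>Suc m\<close> is at least that.\<close>
      finally have 1: "u (Suc m) j + g \<le> real (Suc m) + (p j * delta + A)" using m by simp
      moreover have "p j * delta + A \<le> (1 - p j) * A + p j * B"
        using mult_left_mono[OF AB p_ge[of j]] by (simp add: algebra_simps)
      ultimately show ?thesis by (simp add: bellman_def A_def[symmetric] B_def[symmetric])
    qed
    show "0 < \<bar>h K 0\<bar> + d + delta" using d_ge delta_pos by simp
    show "u l j \<le> (\<bar>h K 0\<bar> + d + delta) * (1 + real l)" for l j
    proof -
      have pj: "delta * (p j - p 0) \<le> delta"
        using mult_left_le[of "p j - p 0" delta] p_le[of j] p_ge[of 0] delta_pos by simp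
      have "u l j \<le> \<bar>h K 0\<bar> + real l * d + delta"
      proof (cases "l \<le> K")
        case True
        have "h l j \<le> h K j" by (rule lift_Suc_mono_le[of "\<lambda>l. h l j"]) (use queue_mono True in auto)
        moreover have "0 \<le> real l * d" using d_ge delta_pos by simp
        ultimately show ?thesis using True hKj[of j] pj by (simp add: u_def)
      next
        case False
        moreover have "0 \<le> real K * d" using d_ge delta_pos by simp
        ultimately show ?thesis using pj by (simp add: u_def algebra_simps)
      qed
      moreover have "0 \<le> \<bar>h K 0\<bar> * real l" "0 \<le> delta * real l" "0 \<le> d" using delta_pos d_ge by auto
      moreover have "(\<bar>h K 0\<bar> + d + delta) * (1 + real l) =
          \<bar>h K 0\<bar> + d + delta + \<bar>h K 0\<bar> * real l + real l * d + delta * real l"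
        by (simp add: algebra_simps)
      ultimately show ?thesis by linarith
    qed
  qed
qed

end

section \<open>Verification of average costs along histories\<close>

lemma finite_set_action: "finite (A :: action set)"
  by (rule finite_subset[of _ "{Continue, Drop}"]) (auto intro: action.exhaust)

lemma finite_set_transition: "finite (set_pmf (transition lam q t a))"
  by (cases t; cases a) auto

declare transition.simps [simp del] cost.simps [simp del]

lemma expectation_bind_finite:
  fixes F :: "'b \<Rightarrow> real"
  assumes "finite (set_pmf M)" "\<And>x. x \<in> set_pmf M \<Longrightarrow> finite (set_pmf (f x))"
  shows "measure_pmf.expectation (bind_pmf M f) F =
    measure_pmf.expectation M (\<lambda>x. measure_pmf.expectation (f x) F)"
  using assms by (simp add: pmf_expectation_bind[of "set_pmf M"] integral_measure_pmf[of "set_pmf M"])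

lemma expectation_mono_finite:
  fixes F G :: "'a \<Rightarrow> real"
  assumes "finite (set_pmf M)" "\<And>x. x \<in> set_pmf M \<Longrightarrow> F x \<le> G x"
  shows "measure_pmf.expectation M F \<le> measure_pmf.expectation M G"
  using assms by (intro integral_mono_AE integrable_measure_pmf_finite) (auto simp: AE_measure_pmf_iff)

text \<open>Drift inequalities are asked only on a closed set \<open>I\<close> containing the start,
  which allows gains that depend on the initial state.\<close>

context
  fixes lam :: real and q :: "nat \<Rightarrow> real" and \<pi> :: policy and I :: "state set" and s :: state
  assumes start: "s \<in> I"
    and invariant: "\<And>hist t a. \<lbrakk>t \<in> I; a \<in> set_pmf (\<pi> hist t)\<rbrakk> \<Longrightarrow> set_pmf (transition lam q t a) \<subseteq> I"
begin

lemma history_invariant: "(hist, t) \<in> set_pmf (history_pmf lam q \<pi> s N) \<Longrightarrow> t \<in> I"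
proof (induction N arbitrary: hist t)
  case 0
  then show ?case using start by simp
next
  case (Suc N)
  then obtain hist' t' a where "(hist', t') \<in> set_pmf (history_pmf lam q \<pi> s N)"
    "a \<in> set_pmf (\<pi> hist' t')" "t \<in> set_pmf (transition lam q t' a)"
    by auto
  then show ?case using invariant Suc.IH by blast
qed

text \<open>Two functions are allowed because the lemma serves both a drift, with
  \<open>\<Psi> = \<Phi> + g\<close>, and the cost increment of a single slot.\<close>

lemma history_step_le:
  fixes \<Phi> \<Psi> :: "(state \<times> action) list \<Rightarrow> state \<Rightarrow> real"
  assumes step: "\<And>hist t a. \<lbrakk>t \<in> I; a \<in> set_pmf (\<pi> hist t)\<rbrakk> \<Longrightarrow>
    \<Psi> hist t \<le> measure_pmf.expectation (transition lam q t a) (\<Phi> (hist @ [(t, a)]))"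
  shows "measure_pmf.expectation (history_pmf lam q \<pi> s N) (\<lambda>(hist, t). \<Psi> hist t)
    \<le> measure_pmf.expectation (history_pmf lam q \<pi> s (Suc N)) (\<lambda>(hist, t). \<Phi> hist t)"
proof -
  let ?next = "\<lambda>hist t a. map_pmf (\<lambda>t'. (hist @ [(t, a)], t')) (transition lam q t a)"
  have fin: "finite (set_pmf (bind_pmf (\<pi> hist t) (?next hist t)))" for hist t
    by (simp add: finite_set_action finite_set_transition)
  have "\<Psi> hist t \<le> measure_pmf.expectation (bind_pmf (\<pi> hist t) (?next hist t)) (\<lambda>(hist, t). \<Phi> hist t)"
    if "t \<in> I" for hist t
  proof -
    have "\<Psi> hist t = measure_pmf.expectation (\<pi> hist t) (\<lambda>_. \<Psi> hist t)" by simp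
    also have "\<dots> \<le> measure_pmf.expectation (\<pi> hist t)
        (\<lambda>a. measure_pmf.expectation (transition lam q t a) (\<Phi> (hist @ [(t, a)])))"
      by (intro expectation_mono_finite finite_set_action step that)
    also have "\<dots> = measure_pmf.expectation (bind_pmf (\<pi> hist t) (?next hist t)) (\<lambda>(hist, t). \<Phi> hist t)"
      by (subst expectation_bind_finite) (simp_all add: finite_set_action finite_set_transition)
    finally show ?thesis .
  qed
  then have "measure_pmf.expectation (history_pmf lam q \<pi> s N) (\<lambda>(hist, t). \<Psi> hist t)
    \<le> measure_pmf.expectation (history_pmf lam q \<pi> s N) (\<lambda>(hist, t).
        measure_pmf.expectation (bind_pmf (\<pi> hist t) (?next hist t)) (\<lambda>(hist, t). \<Phi> hist t))"
    using history_invariant by (intro expectation_mono_finite finite_set_history_pmf) auto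
  also have "\<dots> = measure_pmf.expectation (history_pmf lam q \<pi> s (Suc N)) (\<lambda>(hist, t). \<Phi> hist t)"
    unfolding history_pmf.simps case_prod_unfold
    by (rule expectation_bind_finite[symmetric]) (simp_all only: finite_set_history_pmf fin)
  finally show ?thesis .
qed

lemma history_drift:
  fixes \<Phi> :: "(state \<times> action) list \<Rightarrow> state \<Rightarrow> real"
  assumes step: "\<And>hist t a. \<lbrakk>t \<in> I; a \<in> set_pmf (\<pi> hist t)\<rbrakk> \<Longrightarrow>
    \<Phi> hist t + g \<le> measure_pmf.expectation (transition lam q t a) (\<Phi> (hist @ [(t, a)]))"
  shows "\<Phi> [] s + real N * g
    \<le> measure_pmf.expectation (history_pmf lam q \<pi> s N) (\<lambda>(hist, t). \<Phi> hist t)"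
proof (induction N)
  case (Suc N)
  have "\<Phi> [] s + real (Suc N) * g
    \<le> measure_pmf.expectation (history_pmf lam q \<pi> s N) (\<lambda>(hist, t). \<Phi> hist t) + g"
    using Suc by (simp add: algebra_simps)
  also have "\<dots> = measure_pmf.expectation (history_pmf lam q \<pi> s N) (\<lambda>(hist, t). \<Phi> hist t + g)"
    by (simp add: case_prod_unfold integrable_measure_pmf_finite finite_set_history_pmf)
  also have "\<dots> \<le> measure_pmf.expectation (history_pmf lam q \<pi> s (Suc N)) (\<lambda>(hist, t). \<Phi> hist t)"
    by (rule history_step_le) (use step in auto)
  finally show ?case .
qed simp

lemma expectation_cost_plus:
  "measure_pmf.expectation (history_pmf lam q \<pi> s N) (\<lambda>(hist, t). (\<Sum>(t, a)\<leftarrow>hist. cost delta q t a) + H t)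
    = expected_total_cost lam delta q \<pi> s N
      + measure_pmf.expectation (history_pmf lam q \<pi> s N) (\<lambda>(hist, t). H t)"
  unfolding expected_total_cost_def
  by (simp add: case_prod_unfold integrable_measure_pmf_finite finite_set_history_pmf)

text \<open>Accumulated cost plus \<open>H\<close> of the current state, minus \<open>g\<close> per
  slot, is a submartingale.\<close>

lemma total_cost_ge:
  assumes "\<And>hist t a. \<lbrakk>t \<in> I; a \<in> set_pmf (\<pi> hist t)\<rbrakk> \<Longrightarrow>
    H t + g \<le> cost delta q t a + measure_pmf.expectation (transition lam q t a) H"
  shows "H s + real N * g \<le> expected_total_cost lam delta q \<pi> s N
      + measure_pmf.expectation (history_pmf lam q \<pi> s N) (\<lambda>(hist, t). H t)"
proof -
  define \<Phi> where "\<Phi> hist t = (\<Sum>(t, a)\<leftarrow>hist. cost delta q t a) + H t" for hist t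
  have "\<Phi> [] s + real N * g
    \<le> measure_pmf.expectation (history_pmf lam q \<pi> s N) (\<lambda>(hist, t). \<Phi> hist t)"
  proof (rule history_drift)
    fix hist t a assume "t \<in> I" "a \<in> set_pmf (\<pi> hist t)"
    moreover have "measure_pmf.expectation (transition lam q t a) (\<Phi> (hist @ [(t, a)])) =
        (\<Sum>(t, a)\<leftarrow>hist. cost delta q t a) + cost delta q t a
          + measure_pmf.expectation (transition lam q t a) H"
      by (simp add: \<Phi>_def[abs_def] integrable_measure_pmf_finite finite_set_transition)
    ultimately show "\<Phi> hist t + g \<le> measure_pmf.expectation (transition lam q t a) (\<Phi> (hist @ [(t, a)]))"
      using assms[of t a hist] by (simp add: \<Phi>_def)
  qed
  then show ?thesis unfolding \<Phi>_def expectation_cost_plus by simp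
qed

lemma total_cost_le:
  assumes "\<And>hist t a. \<lbrakk>t \<in> I; a \<in> set_pmf (\<pi> hist t)\<rbrakk> \<Longrightarrow>
    cost delta q t a + measure_pmf.expectation (transition lam q t a) H \<le> H t + g"
  shows "expected_total_cost lam delta q \<pi> s N
      + measure_pmf.expectation (history_pmf lam q \<pi> s N) (\<lambda>(hist, t). H t) \<le> H s + real N * g"
proof -
  \<comment> \<open>The negative sign turns the supermartingale into the submartingale that
    \<open>history_drift\<close> expects.\<close>
  define \<Phi> where "\<Phi> hist t = - ((\<Sum>(t, a)\<leftarrow>hist. cost delta q t a) + H t)" for hist t
  have "\<Phi> [] s + real N * (- g)
    \<le> measure_pmf.expectation (history_pmf lam q \<pi> s N) (\<lambda>(hist, t). \<Phi> hist t)"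
  proof (rule history_drift)
    fix hist t a assume "t \<in> I" "a \<in> set_pmf (\<pi> hist t)"
    moreover have "measure_pmf.expectation (transition lam q t a) (\<Phi> (hist @ [(t, a)])) =
        - ((\<Sum>(t, a)\<leftarrow>hist. cost delta q t a) + cost delta q t a
          + measure_pmf.expectation (transition lam q t a) H)"
      by (simp add: \<Phi>_def[abs_def] integrable_measure_pmf_finite finite_set_transition)
    ultimately show "\<Phi> hist t + (- g) \<le> measure_pmf.expectation (transition lam q t a) (\<Phi> (hist @ [(t, a)]))"
      using assms[of t a hist] by (simp add: \<Phi>_def)
  qed
  moreover have "measure_pmf.expectation (history_pmf lam q \<pi> s N) (\<lambda>(hist, t). \<Phi> hist t) =
    - measure_pmf.expectation (history_pmf lam q \<pi> s N) (\<lambda>(hist, t). (\<Sum>(t, a)\<leftarrow>hist. cost delta q t a) + H t)"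
    by (subst Bochner_Integration.integral_minus[symmetric]) (simp add: \<Phi>_def case_prod_unfold)
  ultimately show ?thesis unfolding expectation_cost_plus by (simp add: \<Phi>_def)
qed

text \<open>The terminal value of \<open>H\<close> is at least \<open>C\<close>, so the total cost
  exceeds \<open>N * g\<close> by at most a constant, which vanishes after division by
  \<open>N\<close>.\<close>

lemma average_cost_le:
  assumes "\<And>hist t a. \<lbrakk>t \<in> I; a \<in> set_pmf (\<pi> hist t)\<rbrakk> \<Longrightarrow>
      cost delta q t a + measure_pmf.expectation (transition lam q t a) H \<le> H t + g"
    and lower: "\<And>t. t \<in> I \<Longrightarrow> C \<le> H t"
  shows "average_cost lam delta q \<pi> s \<le> ereal g"
proof -
  have bound: "expected_total_cost lam delta q \<pi> s N \<le> (H s - C) + real N * g" for N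
  proof -
    have "C = measure_pmf.expectation (history_pmf lam q \<pi> s N) (\<lambda>_. C)" by simp
    also have "\<dots> \<le> measure_pmf.expectation (history_pmf lam q \<pi> s N) (\<lambda>(hist, t). H t)"
      using history_invariant lower by (intro expectation_mono_finite finite_set_history_pmf) auto
    finally have "C \<le> measure_pmf.expectation (history_pmf lam q \<pi> s N) (\<lambda>(hist, t). H t)" .
    moreover have "expected_total_cost lam delta q \<pi> s N
      + measure_pmf.expectation (history_pmf lam q \<pi> s N) (\<lambda>(hist, t). H t) \<le> H s + real N * g"
      by (rule total_cost_le) (rule assms(1))
    ultimately show ?thesis by linarith
  qed
  have "limsup (\<lambda>N. ereal (expected_total_cost lam delta q \<pi> s N / real N))
      \<le> limsup (\<lambda>N. ereal ((H s - C) / real N + g))"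
  proof (rule Limsup_mono, rule eventually_mono[OF eventually_gt_at_top[of 0]])
    fix N :: nat assume "0 < N"
    then show "ereal (expected_total_cost lam delta q \<pi> s N / real N) \<le> ereal ((H s - C) / real N + g)"
      using bound[of N] by (simp add: field_simps)
  qed
  also have "\<dots> = ereal g"
  proof (rule lim_imp_Limsup)
    have "(\<lambda>N. (H s - C) / real N + g) \<longlonglongrightarrow> 0 + g" by (intro tendsto_intros lim_const_over_n)
    then show "(\<lambda>N. ereal ((H s - C) / real N + g)) \<longlonglongrightarrow> ereal g" by simp
  qed simp
  finally show ?thesis by (simp add: average_cost_def)
qed

text \<open>If the average cost were below g, the drift inequality would force the expected queue length,
  hence the cost per slot, to grow without bound.\<close>
lemma average_cost_ge:
  assumes drift: "\<And>hist t a. \<lbrakk>t \<in> I; a \<in> set_pmf (\<pi> hist t)\<rbrakk> \<Longrightarrow>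
      H t + g \<le> cost delta q t a + measure_pmf.expectation (transition lam q t a) H"
    and c: "0 < c" "\<And>t. t \<in> I \<Longrightarrow> H t \<le> c * (1 + real (fst t))"
    and cost: "\<And>t a. t \<in> I \<Longrightarrow> real (fst t) \<le> cost delta q t a"
  shows "ereal g \<le> average_cost lam delta q \<pi> s"
proof (rule ccontr)
  define E where "E N = expected_total_cost lam delta q \<pi> s N" for N
  define L where "L N = measure_pmf.expectation (history_pmf lam q \<pi> s N) (\<lambda>(hist, t). real (fst t))" for N
  assume "\<not> ereal g \<le> average_cost lam delta q \<pi> s"
  then have "limsup (\<lambda>N. ereal (E N / real N)) < ereal g" by (simp add: average_cost_def E_def)
  then obtain x where x: "limsup (\<lambda>N. ereal (E N / real N)) < ereal x" "ereal x < ereal g"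
    using ereal_dense2 by blast
  have "eventually (\<lambda>N. ereal (E N / real N) < ereal x) sequentially"
    using x(1) by (rule Limsup_lessD)
  then have "eventually (\<lambda>N. E N \<le> x * real N) sequentially"
    using eventually_gt_at_top[of 0] by eventually_elim (simp add: field_simps)
  then obtain N0 where N0: "\<And>N. N \<ge> N0 \<Longrightarrow> E N \<le> x * real N"
    by (auto simp: eventually_sequentially)
  have L: "H s + real N * g \<le> E N + c * (1 + L N)" for N
  proof -
    have "measure_pmf.expectation (history_pmf lam q \<pi> s N) (\<lambda>(hist, t). H t)
        \<le> measure_pmf.expectation (history_pmf lam q \<pi> s N) (\<lambda>(hist, t). c * (1 + real (fst t)))"
      using history_invariant c(2) by (intro expectation_mono_finite finite_set_history_pmf) auto
    also have "\<dots> = c * (1 + L N)"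
      by (simp add: L_def case_prod_unfold integrable_measure_pmf_finite finite_set_history_pmf)
    finally have "measure_pmf.expectation (history_pmf lam q \<pi> s N) (\<lambda>(hist, t). H t) \<le> c * (1 + L N)" .
    moreover have "H s + real N * g \<le> E N
      + measure_pmf.expectation (history_pmf lam q \<pi> s N) (\<lambda>(hist, t). H t)"
      unfolding E_def by (rule total_cost_ge) (rule drift)
    ultimately show ?thesis by linarith
  qed
  \<comment> \<open>\<open>L N\<close> averages the state in which slot \<open>Suc N\<close> begins,
    and the cost of that slot enters \<open>E (Suc N)\<close>.\<close>
  have EL: "E N + L N \<le> E (Suc N)" for N
  proof -
    have "E N + L N = measure_pmf.expectation (history_pmf lam q \<pi> s N)
        (\<lambda>(hist, t). (\<Sum>(t, a)\<leftarrow>hist. cost delta q t a) + real (fst t))"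
      unfolding expectation_cost_plus by (simp add: E_def L_def)
    also have "\<dots> \<le> measure_pmf.expectation (history_pmf lam q \<pi> s (Suc N))
        (\<lambda>(hist, t). \<Sum>(t, a)\<leftarrow>hist. cost delta q t a)"
      by (rule history_step_le[where \<Phi> = "\<lambda>hist t. \<Sum>(t, a)\<leftarrow>hist. cost delta q t a"]) (use cost in auto)
    finally show ?thesis by (simp add: E_def expected_total_cost_def)
  qed
  \<comment> \<open>From \<open>N1\<close> on, the lead \<open>N * (g - x)\<close> of the drift
    bound over the cost bound forces \<open>L N\<close> to be at least
    \<open>\<bar>x\<bar> + 1\<close>.\<close>
  obtain N1 where N1: "(c * (\<bar>x\<bar> + 2) + \<bar>H s\<bar>) / (g - x) \<le> real N1" using real_arch_simple by blast
  define M where "M = max N0 N1"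
  have large: "\<bar>x\<bar> + 1 \<le> L N" if "M \<le> N" for N
  proof -
    have "c * (\<bar>x\<bar> + 2) + \<bar>H s\<bar> \<le> real N1 * (g - x)" using N1 x(2) by (simp add: pos_divide_le_eq)
    also have "\<dots> \<le> real N * (g - x)" using that x(2) by (intro mult_right_mono) (auto simp: M_def)
    finally have "c * (\<bar>x\<bar> + 2) \<le> c * (1 + L N)"
      using L[of N] N0[of N] that by (simp add: M_def algebra_simps)
    then show ?thesis using c(1) by simp
  qed
  have grow: "E M + real n * (\<bar>x\<bar> + 1) \<le> E (M + n)" for n
  proof (induction n)
    case (Suc n)
    then show ?case using EL[of "M + n"] large[of "M + n"] by (simp add: algebra_simps)
  qed simp
  \<comment> \<open>Growth at rate \<open>\<bar>x\<bar> + 1\<close> from \<open>M\<close> onwards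
    overtakes the line \<open>x * N\<close>; this \<open>n\<close> lies beyond the crossing.\<close>
  obtain n where n: "\<bar>E M\<bar> + \<bar>x\<bar> * real M < real n" using reals_Archimedean2 by blast
  have "E M + real n * (\<bar>x\<bar> + 1) \<le> x * real (M + n)"
    using order_trans[OF grow[of n] N0[of "M + n"]] by (simp add: M_def trans_le_add1)
  moreover have "x * real (M + n) \<le> \<bar>x\<bar> * real (M + n)" by (intro mult_right_mono) auto
  ultimately show False using n by (simp add: algebra_simps)
qed

end

section \<open>One-step expectations and costs\<close>

lemma expectation_bind_bernoulli:
  fixes F :: "'a \<Rightarrow> real"
  assumes "0 \<le> x" "x \<le> 1" "\<And>b. finite (set_pmf (f b))"
  shows "measure_pmf.expectation (bind_pmf (bernoulli_pmf x) f) F =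
    (1 - x) * measure_pmf.expectation (f False) F + x * measure_pmf.expectation (f True) F"
  using assms by (subst expectation_bind_finite) (simp_all add: algebra_simps)

lemma expectation_transition:
  fixes H :: "state \<Rightarrow> real"
  assumes "0 \<le> lam" "lam \<le> 1" "0 \<le> q k" "q k \<le> 1"
  shows "measure_pmf.expectation (transition lam q (0, k) a) H = (1 - lam) * H (0, k) + lam * H (1, k)"
    and "measure_pmf.expectation (transition lam q (Suc m, k) Drop) H
      = (1 - lam) * H (m, 1) + lam * H (Suc m, 1)"
    and "measure_pmf.expectation (transition lam q (Suc m, k) Continue) H
      = q k * ((1 - lam) * H (m, 1) + lam * H (Suc m, 1))
        + (1 - q k) * ((1 - lam) * H (Suc m, Suc k) + lam * H (Suc (Suc m), Suc k))"
proof -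
  show "measure_pmf.expectation (transition lam q (0, k) a) H = (1 - lam) * H (0, k) + lam * H (1, k)"
    using assms by (simp add: transition.simps expectation_bind_bernoulli)
  show "measure_pmf.expectation (transition lam q (Suc m, k) Drop) H
      = (1 - lam) * H (m, 1) + lam * H (Suc m, 1)"
    using assms by (simp add: transition.simps expectation_bind_bernoulli)
  show "measure_pmf.expectation (transition lam q (Suc m, k) Continue) H
      = q k * ((1 - lam) * H (m, 1) + lam * H (Suc m, 1))
        + (1 - q k) * ((1 - lam) * H (Suc m, Suc k) + lam * H (Suc (Suc m), Suc k))"
  proof -
    have "measure_pmf.expectation (transition lam q (Suc m, k) Continue) H
      = (1 - lam) * (H (m, 1) * q k + H (Suc m, Suc k) * (1 - q k))
        + lam * (H (Suc m, 1) * q k + H (Suc (Suc m), Suc k) * (1 - q k))"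
      using assms by (simp add: transition.simps expectation_bind_bernoulli)
    then show ?thesis by (simp add: algebra_simps)
  qed
qed

lemma transition_in_states:
  assumes "t \<in> states"
  shows "set_pmf (transition lam q t a) \<subseteq> states"
  using assms by (cases t; cases a) (auto simp: transition.simps states_def split: if_splits)

lemma cost_simps:
  "cost delta q (0, k) a = 0"
  "cost delta q (Suc m, k) Continue = real (Suc m)"
  "cost delta q (Suc m, k) Drop = real (Suc m) + delta * (1 - q k)"
  by (simp_all add: cost.simps)

lemma queue_length_le_cost:
  assumes "0 \<le> delta" "q (snd t) \<le> 1"
  shows "real (fst t) \<le> cost delta q t a"
  using assms by (cases t; cases a) (auto simp: cost.simps)

section \<open>The case of an arrival in every slot\<close>

text \<open>A success or drop leaves a busy queue at its length, and a retained failure lengthens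
  it. The gain thus depends on the initial length: always dropping keeps lengths at most
  \<open>l1\<close>, and no policy gets below \<open>l0\<close>.\<close>

lemma always_drop_optimal:
  fixes delta :: real and q :: "nat \<Rightarrow> real"
  assumes delta: "0 < delta" and q: "\<And>k. 1 \<le> k \<Longrightarrow> 0 \<le> q k \<and> q k \<le> 1"
  shows "optimal_policy 1 delta q (\<lambda>_. Drop)"
  unfolding optimal_policy_def
proof (intro ballI allI)
  fix s :: state and \<pi> :: policy
  assume "s \<in> states"
  then obtain l0 k0 where s: "s = (l0, k0)" "1 \<le> k0" by (auto simp: states_def)
  \<comment> \<open>An empty queue has length 1 after one slot.\<close>
  define l1 where "l1 = max l0 1"
  define p where "p k = 1 - q k" for k
  define g where "g = real l1 + delta * p 1"
  have p: "0 \<le> p k" "p k \<le> 1" if "1 \<le> k" for k using q[OF that] by (auto simp: p_def)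
  have dp: "0 \<le> delta * p k" "delta * p k \<le> delta" if "1 \<le> k" for k
    using p[OF that] delta by (auto simp: mult_left_le)
  have "b \<in> set_pmf (bernoulli_pmf 1) \<longleftrightarrow> b" for b by (cases b) (simp_all add: set_pmf_iff)
  then have bernoulli: "set_pmf (bernoulli_pmf 1) = {True}" by auto
  have E: "measure_pmf.expectation (transition 1 q (0, k) a) H = H (1, k)"
    "measure_pmf.expectation (transition 1 q (Suc m, k) Drop) H = H (Suc m, 1)"
    "measure_pmf.expectation (transition 1 q (Suc m, k) Continue) H
      = q k * H (Suc m, 1) + p k * H (Suc (Suc m), Suc k)" if "1 \<le> k" for H m k a
    using q[OF that] by (simp_all add: expectation_transition p_def)
  \<comment> \<open>\<open>H\<close> pays for the first drop, which may happen at a retransmission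
    number other than 1 and cost more than \<open>delta * p 1\<close>.\<close>
  have "average_cost 1 delta q (stationary (\<lambda>_. Drop)) s \<le> ereal g"
  proof (rule average_cost_le[where I = "{(l, k). 1 \<le> k \<and> l \<le> l1}" and C = 0
        and H = "\<lambda>(l, k). if k = 1 then 0 else delta"])
    show "s \<in> {(l, k). 1 \<le> k \<and> l \<le> l1}" using s by (simp add: l1_def)
  next
    fix hist and t :: state and a
    assume t: "t \<in> {(l, k). 1 \<le> k \<and> l \<le> l1}" and "a \<in> set_pmf (stationary (\<lambda>_. Drop) hist t)"
    then have a: "a = Drop" by (simp add: stationary_def)
    obtain l k where lk: "t = (l, k)" "1 \<le> k" "l \<le> l1" using t by auto
    show "set_pmf (transition 1 q t a) \<subseteq> {(l, k). 1 \<le> k \<and> l \<le> l1}"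
      using lk a by (cases l) (auto simp: transition.simps bernoulli l1_def)
    show "cost delta q t a + measure_pmf.expectation (transition 1 q t a) (\<lambda>(l, k). if k = 1 then 0 else delta)
      \<le> (case t of (l, k) \<Rightarrow> if k = 1 then 0 else delta) + g"
    proof (cases l)
      case 0
      then show ?thesis using lk dp[of 1] by (simp add: E cost_simps g_def)
    next
      case (Suc m)
      have "real (Suc m) \<le> real l1" using lk Suc by simp
      then show ?thesis using lk a Suc dp[of 1] dp[of k] by (simp add: E cost_simps g_def p_def[symmetric])
    qed
  qed (use delta in auto)
  also have "ereal g \<le> average_cost 1 delta q \<pi> s"
  proof -
    \<comment> \<open>The slope \<open>2 * delta\<close> makes an added packet outweigh a saved
      penalty. The offset for \<open>k\<close> other than 1 compensates that a drop there may cost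
      less than \<open>delta * p 1\<close>.\<close>
    define v where "v l k = 2 * delta * (real l - real l1) - (if k = 1 then 0 else delta * p 1)" for l k :: nat
    \<comment> \<open>The value at an empty queue makes the drift inequality an equality
      there.\<close>
    define H where "H = (\<lambda>(l, k). if l = 0 then v 1 k - g else v l k)"
    have v1: "v (Suc m) 1 = 2 * delta * (real (Suc m) - real l1)" for m by (simp add: v_def)
    have vS: "v (Suc (Suc m)) (Suc k) = 2 * delta * (real (Suc m) - real l1) + 2 * delta - delta * p 1"
      if "1 \<le> k" for m k using that by (simp add: v_def algebra_simps)
    have upper: "v l k \<le> 2 * delta * real l" for l k
      using dp(1)[of 1] delta by (simp add: v_def algebra_simps)
    show ?thesis
    proof (rule average_cost_ge[where I = "{(l, k). 1 \<le> k \<and> l0 \<le> l}" and H = H and c = "2 * delta"])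
      show "s \<in> {(l, k). 1 \<le> k \<and> l0 \<le> l}" using s by simp
    next
      fix hist and t :: state and a
      assume "t \<in> {(l, k). 1 \<le> k \<and> l0 \<le> l}"
      then obtain l k where lk: "t = (l, k)" "1 \<le> k" "l0 \<le> l" by auto
      show "set_pmf (transition 1 q t a) \<subseteq> {(l, k). 1 \<le> k \<and> l0 \<le> l}"
        using lk by (cases l; cases a) (auto simp: transition.simps bernoulli)
      show "H t + g \<le> cost delta q t a + measure_pmf.expectation (transition 1 q t a) H"
      proof (cases l)
        case 0
        then show ?thesis using lk by (simp add: E cost_simps H_def)
      next
        case (Suc m)
        define w where "w = 2 * delta * (real (Suc m) - real l1)"
        have l1: "real l1 \<le> real (Suc m)" using lk Suc by (simp add: l1_def)
        have t: "H t = w - (if k = 1 then 0 else delta * p 1)" using lk Suc by (simp add: H_def v_def w_def)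
        show ?thesis
        proof (cases a)
          case Drop
          then have "cost delta q t a + measure_pmf.expectation (transition 1 q t a) H
              = real (Suc m) + delta * p k + w"
            using lk Suc by (simp add: E cost_simps H_def v1[unfolded One_nat_def] w_def p_def)
          then show ?thesis using t l1 dp[of 1] dp[of k] lk by (simp add: g_def)
        next
          case Continue
          then have "cost delta q t a + measure_pmf.expectation (transition 1 q t a) H
              = real (Suc m) + q k * w + p k * (w + 2 * delta - delta * p 1)"
            using lk Suc by (simp add: E cost_simps H_def v1[unfolded One_nat_def] vS w_def)
          also have "\<dots> = real (Suc m) + w + p k * (2 * delta - delta * p 1)"
            by (simp add: p_def algebra_simps)
          finally have eq: "cost delta q t a + measure_pmf.expectation (transition 1 q t a) H
              = real (Suc m) + w + p k * (2 * delta - delta * p 1)" .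
          have "p k * delta \<le> p k * (2 * delta - delta * p 1)"
            using p[of k] lk dp[of 1] by (intro mult_left_mono) auto
          then have "(if k = 1 then delta * p 1 else 0) \<le> p k * (2 * delta - delta * p 1)"
            using dp(1)[of k] lk by (auto simp: mult.commute)
          then show ?thesis unfolding eq t using l1 by (auto simp: g_def split: if_splits)
        qed
      qed
    next
      fix t :: state
      assume "t \<in> {(l, k). 1 \<le> k \<and> l0 \<le> l}"
      then obtain l k where lk: "t = (l, k)" "1 \<le> k" "l0 \<le> l" by auto
      have "0 \<le> g" using dp[of 1] by (simp add: g_def)
      then show "H t \<le> 2 * delta * (1 + real (fst t))"
        using upper[of 1 k] upper[of l k] delta lk by (auto simp: H_def algebra_simps)
      show "real (fst t) \<le> cost delta q t a" for a
        using queue_length_le_cost[of delta q t a] delta q[of k] lk by simp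
    qed (use delta in auto)
  qed
  finally show "average_cost 1 delta q (stationary (\<lambda>_. Drop)) s \<le> average_cost 1 delta q \<pi> s" .
qed

section \<open>The case of arrival probability below 1 and the threshold bound\<close>

text \<open>The optimal gain \<open>g\<close> is enclosed from both sides: \<open>h\<close> bounds
  the cost of the greedy policy from above, and the subsolution \<open>u\<close> bounds the cost of
  every policy from below.\<close>

lemma threshold_policy_optimal:
  fixes lam delta :: real and q :: "nat \<Rightarrow> real"
  assumes lam: "0 < lam" "lam < 1" and delta: "0 < delta"
    and q: "\<And>k. 1 \<le> k \<Longrightarrow> 0 \<le> q k \<and> q k \<le> 1"
    and e: "0 < e" "\<And>k. 2 \<le> k \<Longrightarrow> delta * q k + e \<le> real (Suc m0) + lam"
  obtains f where "optimal_policy lam delta q f" "\<And>k. f (0, k) = Drop"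
    "\<And>m k. \<lbrakk>m0 \<le> m; 1 \<le> k\<rbrakk> \<Longrightarrow> f (Suc m, k) = Drop"
proof -
  define p where "p j = 1 - q (Suc j)" for j
  interpret queue lam delta p
    by unfold_locales (use lam delta q in \<open>auto simp: p_def\<close>)
  obtain h g C where h: "\<And>j. h 0 j + g = arrive h 0 j" "\<And>m j. h (Suc m) j + g = bellman 1 h m j"
    "\<And>l j. h l j \<le> h (Suc l) j" "\<And>l i. h l 0 - delta \<le> h (Suc l) i" and C: "\<And>l j. C \<le> h l j"
    using average_cost_optimality_equation[OF lam(2)] by blast
  interpret optimality_equation lam delta p h g
    by unfold_locales (use lam h in auto)
  have drop: "delta \<le> excess m j" if "m0 \<le> m" for m j
    by (rule excess_ge_delta[OF e(1) _ that]) (use e(2) in \<open>auto simp: p_def\<close>)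
  obtain u c where u: "\<And>j. u 0 j + g \<le> arrive u 0 j" "\<And>m j. u (Suc m) j + g \<le> bellman 1 u m j"
    and c: "0 < c" "\<And>l j. u l j \<le> c * (1 + real l)"
    using linear_subsolution[OF drop] by blast
  \<comment> \<open>Ties are resolved in favour of \<open>Drop\<close>, so
    \<open>delta \<le> excess\<close> suffices. At an empty queue \<open>Drop\<close> is chosen so
    that the threshold 0 is possible.\<close>
  define f where "f = (\<lambda>(l, k). if l = 0 \<or> delta \<le> excess (l - 1) (k - 1) then Drop else Continue)"
  have E: "measure_pmf.expectation (transition lam q (0, Suc j) a) (\<lambda>(l, k). v l (k - Suc 0)) = arrive v 0 j"
    "measure_pmf.expectation (transition lam q (Suc m, Suc j) Drop) (\<lambda>(l, k). v l (k - Suc 0)) = arrive v m 0"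
    "measure_pmf.expectation (transition lam q (Suc m, Suc j) Continue) (\<lambda>(l, k). v l (k - Suc 0))
      = (1 - p j) * arrive v m 0 + p j * arrive v (Suc m) (Suc j)" for v m j a
    using lam q[of "Suc j"] by (simp_all add: expectation_transition arrive_def p_def)
  have "optimal_policy lam delta q f"
    unfolding optimal_policy_def
  proof (intro ballI allI)
    fix s \<pi>
    assume s: "s \<in> states"
    have "average_cost lam delta q (stationary f) s \<le> ereal g"
    proof (rule average_cost_le[where I = states and H = "\<lambda>(l, k). h l (k - 1)" and C = C, OF s])
      fix hist and t :: state and a
      assume t: "t \<in> states" and "a \<in> set_pmf (stationary f hist t)"
      then have a: "a = f t" by (simp add: stationary_def)
      show "set_pmf (transition lam q t a) \<subseteq> states" by (rule transition_in_states[OF t])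
      obtain l j where lj: "t = (l, Suc j)" using t
        by (auto simp: states_def dest!: Suc_le_D)
      show "cost delta q t a + measure_pmf.expectation (transition lam q t a) (\<lambda>(l, k). h l (k - 1))
        \<le> (case t of (l, k) \<Rightarrow> h l (k - 1)) + g"
      proof (cases l)
        case 0
        then show ?thesis using lj h(1)[of j] by (simp add: E cost_simps)
      next
        case (Suc m)
        show ?thesis
        proof (cases "delta \<le> excess m j")
          case True
          then have "a = Drop" using a lj Suc by (simp add: f_def)
          then show ?thesis using lj Suc True busy_eq_excess[of m j]
            by (simp add: E cost_simps p_def algebra_simps)
        next
          case False
          then have "a = Continue" using a lj Suc by (simp add: f_def)
          then show ?thesis using lj Suc False busy_eq_excess[of m j]
            by (simp add: E cost_simps excess_def algebra_simps)
        qed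
      qed
    qed (use C in auto)
    also have "ereal g \<le> average_cost lam delta q \<pi> s"
    proof (rule average_cost_ge[where I = states and H = "\<lambda>(l, k). u l (k - 1)" and c = c, OF s])
      fix hist and t :: state and a
      assume t: "t \<in> states"
      show "set_pmf (transition lam q t a) \<subseteq> states" by (rule transition_in_states[OF t])
      obtain l j where lj: "t = (l, Suc j)" using t
        by (auto simp: states_def dest!: Suc_le_D)
      show "(case t of (l, k) \<Rightarrow> u l (k - 1)) + g \<le> cost delta q t a
          + measure_pmf.expectation (transition lam q t a) (\<lambda>(l, k). u l (k - 1))"
      proof (cases l)
        case 0
        then show ?thesis using lj u(1)[of j] by (simp add: E cost_simps)
      next
        case (Suc m)
        then show ?thesis using lj u(2)[of m j]
          by (cases a) (simp_all add: E cost_simps bellman_def p_def algebra_simps)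
      qed
    next
      fix t :: state and a
      assume "t \<in> states"
      then show "real (fst t) \<le> cost delta q t a"
        using queue_length_le_cost[of delta q t a] delta q[of "snd t"] by (auto simp: states_def)
    qed (use c in auto)
    finally show "average_cost lam delta q (stationary f) s \<le> average_cost lam delta q \<pi> s" .
  qed
  then show ?thesis by (rule that) (use drop in \<open>auto simp: f_def\<close>)
qed

theorem theorem2:
  fixes lam delta :: real and q :: "nat \<Rightarrow> real"
  assumes "0 < lam" "lam \<le> 1" "0 < delta"
    and "\<And>k. 1 \<le> k \<Longrightarrow> 0 \<le> q k \<and> q k \<le> 1"
  shows "\<exists>pi_star :: state \<Rightarrow> action.
           optimal_policy lam delta q pi_star \<and>
           (\<exists>l_th :: nat.
              (\<forall>l\<ge>l_th. \<forall>k\<ge>1. pi_star (l, k) = Drop) \<and>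
              real l_th \<le> delta * (SUP k\<in>{1..}. q (k + 1)) + (1 - lam))"
proof -
  define M where "M = (SUP k\<in>{1..}. q (k + 1))"
  define b where "b = delta * M + (1 - lam)"
  have q_le_M: "q k \<le> M" if "2 \<le> k" for k
  proof -
    have "bdd_above ((\<lambda>k. q (k + 1)) ` {1..})" using assms(4) by (intro bdd_aboveI[of _ 1]) auto
    then have "q (k - 1 + 1) \<le> M" unfolding M_def using that by (intro cSUP_upper) auto
    then show ?thesis using that by simp
  qed
  have "0 \<le> M" using q_le_M[of 2] assms(4)[of 2] by simp
  then have b: "0 \<le> b" using assms by (simp add: b_def)
  show ?thesis
  proof (cases "lam = 1")
    case True
    have "optimal_policy lam delta q (\<lambda>_. Drop)"
      unfolding True by (rule always_drop_optimal) (use assms in auto)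
    moreover have "real 0 \<le> b" using b by simp
    ultimately show ?thesis unfolding b_def M_def by blast
  next
    case False
    \<comment> \<open>Rounding down gives \<open>b < l_th + 1\<close>, and the positive difference
      is the margin \<open>e\<close> of the iteration.\<close>
    define l_th where "l_th = nat \<lfloor>b\<rfloor>"
    have l_th: "real l_th \<le> b" "b < real l_th + 1"
      using b by (auto simp: l_th_def of_nat_nat)
    \<comment> \<open>The index \<open>m\<close> stands for queue length \<open>Suc m\<close>, hence
      \<open>l_th - 1\<close>. For \<open>l_th = 0\<close> the subtraction truncates, and the empty
      queue is covered by \<open>f (0, k) = Drop\<close>.\<close>
    obtain f where f: "optimal_policy lam delta q f" "\<And>k. f (0, k) = Drop"
      "\<And>m k. \<lbrakk>l_th - 1 \<le> m; 1 \<le> k\<rbrakk> \<Longrightarrow> f (Suc m, k) = Drop"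
    proof (rule threshold_policy_optimal[of lam delta q "real l_th + 1 - b" "l_th - 1"])
      show "delta * q k + (real l_th + 1 - b) \<le> real (Suc (l_th - 1)) + lam" if "2 \<le> k" for k
      proof -
        have "delta * q k \<le> delta * M" using q_le_M[OF that] assms(3) by simp
        moreover have "real l_th \<le> real (Suc (l_th - 1))" by simp
        ultimately show ?thesis by (simp add: b_def)
      qed
    qed (use assms False l_th in auto)
    have "f (l, k) = Drop" if "l_th \<le> l" "1 \<le> k" for l k
      using that f(2,3) by (cases l) auto
    then show ?thesis using f(1) l_th(1) unfolding b_def M_def by blast
  qed
qed

end
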